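(* Fix $t\in[0,T)$ and let $$V_t^{(2)}=\int_t^T\mathbb{E}\Big[\big(V_u^{(1)}\partial_v+Z_u^{a(1)}\partial_{z^a}\big)f\big(X_u,v^{(0)}(X_u),z^{(0)}(X_u)\big)\,\Big|\,\mathcal{F}_t\Big]\,du .$$ Let $\tau_1,\tau_2$ be two sequential interaction times, started at $t$, randomly drawn with deterministic positive intensity $\lambda$ independently of $W$. Then, with repeated indices summed ($a$ over $\{1,\dots,r\}$, $i$ over $\{1,\dots,d\}$), $$V_t^{(2)}=\mathbf{1}_{\{\tau_1>t\}}\mathbb{E}\Big[\mathbf{1}_{\{\tau_1<\tau_2<T\}}(\partial_v\hat f_{t,\tau_1})\hat f_{\tau_1,\tau_2}\Big|\mathcal{F}_t\Big]+\mathbf{1}_{\{\tau_1>t\}}\mathbb{E}\Big[\mathbf{1}_{\{\tau_1<\tau_2<T\}}\,(\partial_{z^a}\hat f_{t,\tau_1})\,\big(Y_{\tau_1,\tau_2}\gamma_{\tau_1}\big)^i_a\,\nabla_{i,\tau_2}\hat f_{\tau_1,\tau_2}\Big|\mathcal{F}_t\Big].$$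
   Context: Let $(\Omega,\mathcal{F},P)$ be a probability space, $T\in(0,\infty)$, $W=(W^1,\dots,W^r)$ an $r$-dimensional Brownian motion, and $(\mathcal{F}_t)_{0\le t\le T}$ its $P$-augmented natural filtration. The forward process $X$ in $\mathbb{R}^d$ solves $dX_s=\gamma_0(X_s)ds+\gamma(X_s)\cdot dW_s$, with $\gamma_0:\mathbb{R}^d\to\mathbb{R}^d$, $\gamma=(\gamma^i_a):\mathbb{R}^d\to\mathbb{R}^{d\times r}$ (time may be one of the components of $X$). The driver is $f(x,v,z)$ with $x\in\mathbb{R}^d$, $v\in\mathbb{R}$, $z\in\mathbb{R}^r$. The functions $v^{(0)}:\mathbb{R}^d\to\mathbb{R}$ and $z^{(0)}:\mathbb{R}^d\to\mathbb{R}^r$ are given deterministic functions representing the solution $V^{(0)}_s=v^{(0)}(X_s)$, $Z^{(0)}_s=z^{(0)}(X_s)$ of $dV^{(0)}_s=Z^{(0)}_s\cdot dW_s$, $V^{(0)}_T=\Psi(X_T)$, where $\Psi$ is a deterministic function. Further, with $\mathcal D$ the Malliavin derivative, $V^{(1)}_s=\int_s^T\mathbb{E}[f(X_u,v^{(0)}(X_u),z^{(0)}(X_u))|\mathcal{F}_s]du$ and $Z^{(1)}_s=\int_s^T\mathbb{E}[\mathcal{D}_sf(X_u,v^{(0)}(X_u),z^{(0)}(X_u))|\mathcal{F}_s]du\in\mathbb{R}^r$ (components $Z^{a(1)}_s$). Stochastic flow: for $u\ge s$, $Y_{s,u}\in\mathbb{R}^{d\times d}$ solves $d(Y_{s,u})^i_j=\partial_k\gamma^i_0(X_u)(Y_{s,u})^k_j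 du+\partial_k\gamma^i_a(X_u)(Y_{s,u})^k_j dW^a_u$ in $u$, $(Y_{s,s})^i_j=\delta^i_j$; and $\mathcal{D}^a_sX^i_u=(Y_{s,u}\gamma(X_s))^i_a=(Y_{s,u})^i_j\gamma^j_a(X_s)$. Notation: $\gamma_s=\gamma(X_s)$. For a function $g(x,v,z)$, $\nabla_i g=\{\partial_i+\partial_iv^{(0)}(x)\partial_v+\partial_iz^{a(0)}(x)\partial_{z^a}\}g$ evaluated at $(x,v^{(0)}(x),z^{(0)}(x))$ (i.e. the total $x^i$-derivative of $g(x,v^{(0)}(x),z^{(0)}(x))$), and $\nabla_{i,s}$ means evaluation at $x=X_s$. For $t\le s$, $\hat f_{t,s}=\frac{1}{\lambda_s}e^{\int_t^s\lambda_u du}f(X_s,v^{(0)}(X_s),z^{(0)}(X_s))$; derivatives of $\hat f_{t,s}$ act on $f$ only and keep the prefactor: e.g. $\partial_v\hat f_{t,s}=\frac{1}{\lambda_s}e^{\int_t^s\lambda_udu}(\partial_vf)(X_s,v^{(0)}(X_s),z^{(0)}(X_s))$. Interaction times: $\lambda:[0,T]\to(0,\infty)$ is deterministic and integrable. The probability space is enlarged to carry $\tau_1<\tau_2$, independent of $W$, the first two event times after $t$ of a Poisson process of intensity $\lambda$: $P(\tau_1>s)=e^{-\int_t^s\lambda_udu}$ for $s\in[t,T]$, and on $\{\tau_1<T\}$, $P(\tau_2>s\,|\,\tau_1)=e^{-\int_{\tau_1}^s\lambda_udu}$ for $s\in[\tau_1,T]$. Standing assumption: appropriate regularity, meaning that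 the SDEs for $X,Y$ have unique strong solutions, $X_u$ is Malliavin differentiable with the stated derivative, $f,v^{(0)},z^{(0)}$ have the derivatives that appear and the Malliavin chain rule applies, and all integrands are absolutely integrable. *)

theory Defs
  imports "HOL-Probability.Probability"
begin

definition natural_filtration :: "'a measure \<Rightarrow> (real \<Rightarrow> 'a \<Rightarrow> real^'r) \<Rightarrow> real \<Rightarrow> 'a measure" where
  "natural_filtration M W s =
     sigma (space M) (\<Union>u\<in>{0..s}. {W u -` B \<inter> space M | B. B \<in> sets borel})"

definition augmented_filtration :: "'a measure \<Rightarrow> (real \<Rightarrow> 'a \<Rightarrow> real^'r) \<Rightarrow> real \<Rightarrow> 'a measure" where
  "augmented_filtration M W s =
     sigma (space M) (sets (natural_filtration M W s) \<union> null_sets M)"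

definition brownian_motion :: "'a measure \<Rightarrow> real \<Rightarrow> (real \<Rightarrow> 'a \<Rightarrow> real^'r) \<Rightarrow> bool" where
  "brownian_motion M T W \<longleftrightarrow>
     (\<forall>s\<in>{0..T}. W s \<in> borel_measurable M) \<and>
     (AE \<omega> in M. W 0 \<omega> = 0) \<and>
     (AE \<omega> in M. continuous_on {0..T} (\<lambda>s. W s \<omega>)) \<and>
     (\<forall>s u. 0 \<le> s \<and> s < u \<and> u \<le> T \<longrightarrow>
        prob_space.indep_set M
          (sets (vimage_algebra (space M) (\<lambda>\<omega>. W u \<omega> - W s \<omega>) borel))
          (sets (natural_filtration M W s)) \<and>
        prob_space.indep_vars M (\<lambda>_. borel) (\<lambda>a \<omega>. (W u \<omega> - W s \<omega>) $ a) UNIV \<and>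
        (\<forall>a. distributed M lborel (\<lambda>\<omega>. (W u \<omega> - W s \<omega>) $ a)
               (\<lambda>x. ennreal (normal_density 0 (sqrt (u - s)) x))))"

definition converges_in_prob :: "'a measure \<Rightarrow> (nat \<Rightarrow> 'a \<Rightarrow> real) \<Rightarrow> ('a \<Rightarrow> real) \<Rightarrow> bool" where
  "converges_in_prob M Q R \<longleftrightarrow>
     (\<forall>\<epsilon>>0. (\<lambda>m. measure M {\<omega>\<in>space M. \<epsilon> < \<bar>Q m \<omega> - R \<omega>\<bar>}) \<longlonglongrightarrow> 0)"

text \<open>A simple process takes the bounded value \<open>\<xi> k\<close>, known at time \<open>\<pi> k\<close>, on the
  interval from \<open>\<pi> k\<close> (excluded) to \<open>\<pi> (k + 1)\<close>, for \<open>k < n\<close>.\<close>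

definition simple_integrand ::
  "'a measure \<Rightarrow> (real \<Rightarrow> 'a \<Rightarrow> real^'r) \<Rightarrow> real \<Rightarrow> real \<Rightarrow>
   nat \<Rightarrow> (nat \<Rightarrow> real) \<Rightarrow> (nat \<Rightarrow> 'a \<Rightarrow> real^'r) \<Rightarrow> bool" where
  "simple_integrand M W s u n \<pi> \<xi> \<longleftrightarrow>
     \<pi> 0 = s \<and> \<pi> n = u \<and> (\<forall>k<n. \<pi> k \<le> \<pi> (Suc k)) \<and>
     (\<forall>k<n. \<xi> k \<in> borel_measurable (augmented_filtration M W (\<pi> k)) \<and>
            (\<exists>C. \<forall>\<omega>\<in>space M. norm (\<xi> k \<omega>) \<le> C))"

definition simple_process ::
  "nat \<Rightarrow> (nat \<Rightarrow> real) \<Rightarrow> (nat \<Rightarrow> 'a \<Rightarrow> real^'r) \<Rightarrow> real \<Rightarrow> 'a \<Rightarrow> real^'r" where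
  "simple_process n \<pi> \<xi> q \<omega> = (\<Sum>k<n. indicator {\<pi> k<..\<pi> (Suc k)} q *\<^sub>R \<xi> k \<omega>)"

definition simple_integral ::
  "(real \<Rightarrow> 'a \<Rightarrow> real^'r) \<Rightarrow> nat \<Rightarrow> (nat \<Rightarrow> real) \<Rightarrow> (nat \<Rightarrow> 'a \<Rightarrow> real^'r) \<Rightarrow> 'a \<Rightarrow> real" where
  "simple_integral W n \<pi> \<xi> \<omega> = (\<Sum>k<n. \<xi> k \<omega> \<bullet> (W (\<pi> (Suc k)) \<omega> - W (\<pi> k) \<omega>))"

text \<open>\<open>adapted_measurable M W s u H\<close>: on the time interval from \<open>s\<close> to \<open>u\<close>, the process \<open>H\<close> is
  adapted and jointly measurable. Joint measurability is with respect to \<open>\<F>\<^sub>u\<close> and not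
  just \<open>M\<close>, because \<open>M\<close> may carry randomness that is independent of \<open>W\<close>.\<close>

definition adapted_measurable ::
  "'a measure \<Rightarrow> (real \<Rightarrow> 'a \<Rightarrow> real^'r) \<Rightarrow> real \<Rightarrow> real \<Rightarrow>
   (real \<Rightarrow> 'a \<Rightarrow> 'b::{second_countable_topology, real_normed_vector}) \<Rightarrow> bool" where
  "adapted_measurable M W s u H \<longleftrightarrow>
     (\<forall>q\<in>{s..u}. H q \<in> borel_measurable (augmented_filtration M W q)) \<and>
     (\<lambda>(q, \<omega>). indicator {s..u} q *\<^sub>R H q \<omega>)
        \<in> borel_measurable (lborel \<Otimes>\<^sub>M augmented_filtration M W u)"

text \<open>\<open>is_ito_integral M W s u H I\<close>: the random variable \<open>I\<close> is a version of
  \<open>\<integral>\<^sub>s\<^sup>u H\<^sub>q \<cdot> dW\<^sub>q\<close>.\<close>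

definition is_ito_integral ::
  "'a measure \<Rightarrow> (real \<Rightarrow> 'a \<Rightarrow> real^'r) \<Rightarrow> real \<Rightarrow> real \<Rightarrow>
   (real \<Rightarrow> 'a \<Rightarrow> real^'r) \<Rightarrow> ('a \<Rightarrow> real) \<Rightarrow> bool" where
  "is_ito_integral M W s u H I \<longleftrightarrow>
     I \<in> borel_measurable M \<and>
     adapted_measurable M W s u H \<and>
     (AE \<omega> in M. set_integrable lborel {s..u} (\<lambda>q. (norm (H q \<omega>))\<^sup>2)) \<and>
     (\<exists>n \<pi> \<xi>.
        (\<forall>m. simple_integrand M W s u (n m) (\<pi> m) (\<xi> m)) \<and>
        converges_in_prob M
          (\<lambda>m \<omega>. LINT q:{s..u}|lborel. (norm (simple_process (n m) (\<pi> m) (\<xi> m) q \<omega> - H q \<omega>))\<^sup>2)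
          (\<lambda>_. 0) \<and>
        converges_in_prob M (\<lambda>m. simple_integral W (n m) (\<pi> m) (\<xi> m)) I)"

text \<open>\<open>X\<close> is a continuous adapted real process with
  \<open>dX\<^sub>u = b\<^sub>u du + \<sigma>\<^sub>u \<cdot> dW\<^sub>u\<close> for \<open>u\<close> between \<open>s\<close> and \<open>T\<close>.\<close>

definition ito_process ::
  "'a measure \<Rightarrow> (real \<Rightarrow> 'a \<Rightarrow> real^'r) \<Rightarrow> real \<Rightarrow> real \<Rightarrow>
   (real \<Rightarrow> 'a \<Rightarrow> real) \<Rightarrow> (real \<Rightarrow> 'a \<Rightarrow> real^'r) \<Rightarrow> (real \<Rightarrow> 'a \<Rightarrow> real) \<Rightarrow> bool" where
  "ito_process M W s T b \<sigma> X \<longleftrightarrow>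
     adapted_measurable M W s T X \<and>
     adapted_measurable M W s T b \<and>
     (AE \<omega> in M. continuous_on {s..T} (\<lambda>u. X u \<omega>)) \<and>
     (AE \<omega> in M. set_integrable lborel {s..T} (\<lambda>q. b q \<omega>)) \<and>
     (\<forall>u\<in>{s..T}. \<exists>I. is_ito_integral M W s u \<sigma> I \<and>
        (AE \<omega> in M. X u \<omega> = X s \<omega> + (LINT q:{s..u}|lborel. b q \<omega>) + I \<omega>))"

text \<open>Strong solutions on the time interval from \<open>s\<close> to \<open>T\<close>, started from \<open>\<eta>\<close> at time \<open>s\<close>, of
  \<open>dX\<^sub>u = b\<^sub>u(X\<^sub>u) du + \<sigma>\<^sub>u(X\<^sub>u) \<cdot> dW\<^sub>u\<close>; the coefficients may be random, as is the case for
  the stochastic flow.\<close>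

definition sde_solution ::
  "'a measure \<Rightarrow> (real \<Rightarrow> 'a \<Rightarrow> real^'r) \<Rightarrow> real \<Rightarrow> real \<Rightarrow>
   (real \<Rightarrow> 'a \<Rightarrow> real^'n \<Rightarrow> real^'n) \<Rightarrow> (real \<Rightarrow> 'a \<Rightarrow> real^'n \<Rightarrow> real^'r^'n) \<Rightarrow>
   ('a \<Rightarrow> real^'n) \<Rightarrow> (real \<Rightarrow> 'a \<Rightarrow> real^'n) \<Rightarrow> bool" where
  "sde_solution M W s T b \<sigma> \<eta> X \<longleftrightarrow>
     (AE \<omega> in M. X s \<omega> = \<eta> \<omega>) \<and>
     (\<forall>i. ito_process M W s T
            (\<lambda>u \<omega>. b u \<omega> (X u \<omega>) $ i) (\<lambda>u \<omega>. \<sigma> u \<omega> (X u \<omega>) $ i) (\<lambda>u \<omega>. X u \<omega> $ i))"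

definition sde_unique_solution ::
  "'a measure \<Rightarrow> (real \<Rightarrow> 'a \<Rightarrow> real^'r) \<Rightarrow> real \<Rightarrow> real \<Rightarrow>
   (real \<Rightarrow> 'a \<Rightarrow> real^'n \<Rightarrow> real^'n) \<Rightarrow> (real \<Rightarrow> 'a \<Rightarrow> real^'n \<Rightarrow> real^'r^'n) \<Rightarrow>
   ('a \<Rightarrow> real^'n) \<Rightarrow> (real \<Rightarrow> 'a \<Rightarrow> real^'n) \<Rightarrow> bool" where
  "sde_unique_solution M W s T b \<sigma> \<eta> X \<longleftrightarrow>
     sde_solution M W s T b \<sigma> \<eta> X \<and>
     (\<forall>X'. sde_solution M W s T b \<sigma> \<eta> X' \<longrightarrow> (AE \<omega> in M. \<forall>u\<in>{s..T}. X' u \<omega> = X u \<omega>))"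

definition partial :: "'n \<Rightarrow> (real^'n \<Rightarrow> real) \<Rightarrow> real^'n \<Rightarrow> real" where
  "partial k g x = deriv (\<lambda>h. g (x + h *\<^sub>R axis k 1)) 0"

definition d_x :: "'d \<Rightarrow> (real^'d \<Rightarrow> real \<Rightarrow> real^'r \<Rightarrow> real) \<Rightarrow> real^'d \<Rightarrow> real \<Rightarrow> real^'r \<Rightarrow> real" where
  "d_x i g x v z = partial i (\<lambda>y. g y v z) x"

definition d_v :: "(real^'d \<Rightarrow> real \<Rightarrow> real^'r \<Rightarrow> real) \<Rightarrow> real^'d \<Rightarrow> real \<Rightarrow> real^'r \<Rightarrow> real" where
  "d_v g x v z = deriv (\<lambda>y. g x y z) v"

definition d_z :: "'r \<Rightarrow> (real^'d \<Rightarrow> real \<Rightarrow> real^'r \<Rightarrow> real) \<Rightarrow> real^'d \<Rightarrow> real \<Rightarrow> real^'r \<Rightarrow> real" where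
  "d_z a g x v z = partial a (\<lambda>y. g x v y) z"

text \<open>The operator \<open>\<nabla>\<^sub>i = \<partial>\<^sub>i + \<partial>\<^sub>iv\<^sup>0(x) \<partial>\<^sub>v + \<partial>\<^sub>iz\<^sup>0(x) \<cdot> \<partial>\<^sub>z\<close>; here and below, \<open>v0\<close> and \<open>z0\<close>
  are the functions giving the order-zero solution.\<close>

definition nabla ::
  "(real^'d \<Rightarrow> real) \<Rightarrow> (real^'d \<Rightarrow> real^'r) \<Rightarrow> 'd \<Rightarrow>
   (real^'d \<Rightarrow> real \<Rightarrow> real^'r \<Rightarrow> real) \<Rightarrow> real^'d \<Rightarrow> real \<Rightarrow> real^'r \<Rightarrow> real" where
  "nabla v0 z0 i g x v z =
     d_x i g x v z + partial i v0 x * d_v g x v z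
       + (\<Sum>a\<in>UNIV. partial i (\<lambda>y. z0 y $ a) x * d_z a g x v z)"

definition along ::
  "(real^'d \<Rightarrow> real) \<Rightarrow> (real^'d \<Rightarrow> real^'r) \<Rightarrow> (real \<Rightarrow> 'a \<Rightarrow> real^'d) \<Rightarrow>
   (real^'d \<Rightarrow> real \<Rightarrow> real^'r \<Rightarrow> real) \<Rightarrow> real \<Rightarrow> 'a \<Rightarrow> real" where
  "along v0 z0 X g s \<omega> = g (X s \<omega>) (v0 (X s \<omega>)) (z0 (X s \<omega>))"

text \<open>With \<open>g = f\<close> this is \<open>f\<close> decorated with a hat; its derivatives, which keep the prefactor, are
  obtained with \<open>g = d_v f\<close>, \<open>g = d_z a f\<close> and \<open>g = nabla v0 z0 i f\<close>.\<close>

definition hat ::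
  "(real \<Rightarrow> real) \<Rightarrow> (real^'d \<Rightarrow> real) \<Rightarrow> (real^'d \<Rightarrow> real^'r) \<Rightarrow> (real \<Rightarrow> 'a \<Rightarrow> real^'d) \<Rightarrow>
   (real^'d \<Rightarrow> real \<Rightarrow> real^'r \<Rightarrow> real) \<Rightarrow> real \<Rightarrow> real \<Rightarrow> 'a \<Rightarrow> real" where
  "hat lam v0 z0 X g t s \<omega> =
     1 / lam s * exp (LINT u:{t..s}|lborel. lam u) * along v0 z0 X g s \<omega>"

text \<open>Every column of \<open>Y s u\<close> solves the linear equation obtained by differentiating the coefficients
  \<open>\<gamma>0\<close> and \<open>\<gamma>\<close> of the equation for \<open>X\<close>; the matrix equation is the system of these
  decoupled equations.\<close>

definition stochastic_flow ::
  "'a measure \<Rightarrow> real \<Rightarrow> (real \<Rightarrow> 'a \<Rightarrow> real^'r) \<Rightarrow> (real^'d \<Rightarrow> real^'d) \<Rightarrow> (real^'d \<Rightarrow> real^'r^'d) \<Rightarrow>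
   (real \<Rightarrow> 'a \<Rightarrow> real^'d) \<Rightarrow> (real \<Rightarrow> real \<Rightarrow> 'a \<Rightarrow> real^'d^'d) \<Rightarrow> bool" where
  "stochastic_flow M T W \<gamma>0 \<gamma> X Y \<longleftrightarrow>
     (\<forall>s\<in>{0..T}. \<forall>j.
        sde_unique_solution M W s T
          (\<lambda>u \<omega> y. \<chi> i. \<Sum>k\<in>UNIV. partial k (\<lambda>x. \<gamma>0 x $ i) (X u \<omega>) * y $ k)
          (\<lambda>u \<omega> y. \<chi> i a. \<Sum>k\<in>UNIV. partial k (\<lambda>x. \<gamma> x $ i $ a) (X u \<omega>) * y $ k)
          (\<lambda>_. axis j 1)
          (\<lambda>u \<omega>. column j (Y s u \<omega>)))"

text \<open>\<open>smooth_family n G\<close>: \<open>G []\<close> is a smooth function of the first \<open>n\<close> coordinates which, together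
  with all its partial derivatives, has polynomial growth; \<open>G (j # \<alpha>)\<close> is the
  \<open>j\<close>-th partial derivative of \<open>G \<alpha>\<close>.\<close>

definition smooth_family :: "nat \<Rightarrow> (nat list \<Rightarrow> (nat \<Rightarrow> real) \<Rightarrow> real) \<Rightarrow> bool" where
  "smooth_family n G \<longleftrightarrow>
     (\<forall>\<alpha>. set \<alpha> \<subseteq> {..<n} \<longrightarrow>
        (\<forall>x y. (\<forall>j<n. x j = y j) \<longrightarrow> G \<alpha> x = G \<alpha> y) \<and>
        continuous_on UNIV (G \<alpha>) \<and>
        (\<exists>C m. \<forall>x. \<bar>G \<alpha> x\<bar> \<le> C * (1 + (\<Sum>j<n. \<bar>x j\<bar>)) ^ m) \<and>
        (\<forall>j<n. \<forall>x. ((\<lambda>y. G \<alpha> (x(j := y))) has_real_derivative G (j # \<alpha>) x) (at (x j))))"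

text \<open>Smooth random variables \<open>F = g(W(h\<^sub>0),\<dots>,W(h\<^sub>n\<^sub>-\<^sub>1))\<close>, where \<open>W(h) = \<integral>\<^sub>0\<^sup>T h(s) \<cdot> dW\<^sub>s\<close>
  for square integrable \<open>h\<close>, and their derivative
  \<open>\<D>\<^sub>s F = \<Sum>j. \<partial>\<^sub>j g(W(h\<^sub>0),\<dots>,W(h\<^sub>n\<^sub>-\<^sub>1)) h\<^sub>j(s)\<close>.\<close>

definition smooth_random_variable ::
  "'a measure \<Rightarrow> real \<Rightarrow> (real \<Rightarrow> 'a \<Rightarrow> real^'r) \<Rightarrow>
   ('a \<Rightarrow> real) \<Rightarrow> (real \<Rightarrow> 'a \<Rightarrow> real^'r) \<Rightarrow> bool" where
  "smooth_random_variable M T W F DF \<longleftrightarrow>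
     (\<exists>n G h Wh.
        smooth_family n G \<and>
        (\<forall>j<n. h j \<in> borel_measurable borel \<and> is_ito_integral M W 0 T (\<lambda>s _. h j s) (Wh j)) \<and>
        (\<forall>\<omega>\<in>space M. F \<omega> = G [] (\<lambda>j. Wh j \<omega>)) \<and>
        (\<forall>s\<in>{0..T}. \<forall>\<omega>\<in>space M. DF s \<omega> = (\<Sum>j<n. G [j] (\<lambda>j. Wh j \<omega>) *\<^sub>R h j s)))"

text \<open>\<open>has_malliavin_derivative M T W F DF\<close>: \<open>F\<close> belongs to the domain of the closure of \<open>\<D>\<close> as an
  operator from \<open>L\<^sup>2(\<Omega>)\<close> to \<open>L\<^sup>2([0,T] \<times> \<Omega>)\<close>, and \<open>DF s \<omega>\<close> is a version of \<open>(\<D>\<^sub>s F)(\<omega>)\<close>.\<close>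

definition has_malliavin_derivative ::
  "'a measure \<Rightarrow> real \<Rightarrow> (real \<Rightarrow> 'a \<Rightarrow> real^'r) \<Rightarrow>
   ('a \<Rightarrow> real) \<Rightarrow> (real \<Rightarrow> 'a \<Rightarrow> real^'r) \<Rightarrow> bool" where
  "has_malliavin_derivative M T W F DF \<longleftrightarrow>
     F \<in> borel_measurable M \<and>
     (\<lambda>(s, \<omega>). indicator {0..T} s *\<^sub>R DF s \<omega>) \<in> borel_measurable (lborel \<Otimes>\<^sub>M M) \<and>
     (\<exists>Fn DFn.
        (\<forall>m. smooth_random_variable M T W (Fn m) (DFn m)) \<and>
        (\<lambda>m. \<integral>\<^sup>+\<omega>. ennreal ((Fn m \<omega> - F \<omega>)\<^sup>2) \<partial>M) \<longlonglongrightarrow> 0 \<and>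
        (\<lambda>m. \<integral>\<^sup>+(s, \<omega>). ennreal (indicator {0..T} s * (norm (DFn m s \<omega> - DF s \<omega>))\<^sup>2)
               \<partial>(lborel \<Otimes>\<^sub>M M)) \<longlonglongrightarrow> 0)"

text \<open>\<open>R = \<integral>\<^sub>s\<^sup>T E[g\<^sub>u | F] du\<close>. Conditional expectations are only determined up to a null set
  for every \<open>u\<close>, so the integrand has to be a jointly measurable version \<open>C\<close> of
  \<open>E[g\<^sub>u | F]\<close>; \<open>R\<close> is then determined almost surely.\<close>

definition is_integral_of_cond_exp ::
  "'a measure \<Rightarrow> 'a measure \<Rightarrow> real \<Rightarrow> real \<Rightarrow> (real \<Rightarrow> 'a \<Rightarrow> real) \<Rightarrow> ('a \<Rightarrow> real) \<Rightarrow> bool" where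
  "is_integral_of_cond_exp M F s T g R \<longleftrightarrow>
     integrable (lborel \<Otimes>\<^sub>M M) (\<lambda>(u, \<omega>). indicator {s..T} u * g u \<omega>) \<and>
     (\<exists>C. (\<lambda>(u, \<omega>). C u \<omega>) \<in> borel_measurable (lborel \<Otimes>\<^sub>M M) \<and>
        (AE u in lborel. u \<in> {s..T} \<longrightarrow> (AE \<omega> in M. C u \<omega> = real_cond_exp M F (g u) \<omega>)) \<and>
        (AE \<omega> in M. R \<omega> = (LINT u:{s..T}|lborel. C u \<omega>)))"

text \<open>The first two event times after \<open>t\<close> of a Poisson process of intensity \<open>lam\<close>, independent of
  \<open>W\<close>. Only their behaviour up to time \<open>T\<close> is prescribed: an event that does not happen
  before \<open>T\<close> is assigned an arbitrary later time.\<close>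

definition interaction_times ::
  "'a measure \<Rightarrow> real \<Rightarrow> (real \<Rightarrow> 'a \<Rightarrow> real^'r) \<Rightarrow> (real \<Rightarrow> real) \<Rightarrow> real \<Rightarrow>
   ('a \<Rightarrow> real) \<Rightarrow> ('a \<Rightarrow> real) \<Rightarrow> bool" where
  "interaction_times M T W lam t \<tau>\<^sub>1 \<tau>\<^sub>2 \<longleftrightarrow>
     \<tau>\<^sub>1 \<in> borel_measurable M \<and> \<tau>\<^sub>2 \<in> borel_measurable M \<and>
     (AE \<omega> in M. \<tau>\<^sub>1 \<omega> < \<tau>\<^sub>2 \<omega>) \<and>
     prob_space.indep_set M
       (sets (vimage_algebra (space M) (\<lambda>\<omega>. (\<tau>\<^sub>1 \<omega>, \<tau>\<^sub>2 \<omega>)) borel))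
       (sets (natural_filtration M W T)) \<and>
     (\<forall>s\<in>{t..T}. measure M {\<omega>\<in>space M. s < \<tau>\<^sub>1 \<omega>} = exp (- (LINT u:{t..s}|lborel. lam u))) \<and>
     (\<forall>s\<in>{t..T}. AE \<omega> in M. \<tau>\<^sub>1 \<omega> < T \<and> \<tau>\<^sub>1 \<omega> \<le> s \<longrightarrow>
        real_cond_exp M (vimage_algebra (space M) \<tau>\<^sub>1 borel)
          (indicator {\<omega>\<in>space M. s < \<tau>\<^sub>2 \<omega>}) \<omega>
        = exp (- (LINT u:{\<tau>\<^sub>1 \<omega>..s}|lborel. lam u)))"

end

theory Submission
  imports Defs
begin

text \<open>On \<open>t < x < y < T\<close> the interaction times \<open>(\<tau>\<^sub>1, \<tau>\<^sub>2)\<close> have the density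
  \<open>\<lambda>\<^sub>x \<lambda>\<^sub>y exp (- \<integral>\<^sub>t\<^sup>y \<lambda>\<^sub>u du)\<close>, which is exactly the inverse of the product of the prefactors of the
  two hatted factors. Since the interaction times are independent of \<open>W\<close>, integrating them out turns
  the right-hand side into an integral over \<open>t < x < y < T\<close> of a product of a factor known at
  time \<open>x\<close> and the driver, respectively its Malliavin derivative, at time \<open>y\<close>. By the
  tower property the inner integral over \<open>y\<close>, conditioned on the information at time \<open>x\<close>, is
  \<open>V\<^sup>1\<close>, respectively \<open>Z\<^sup>1\<close>, which gives the left-hand side. The two product terms are treated jointly,
  as only the sum of the integrands of \<open>V\<^sup>2\<close> is assumed to be integrable.\<close>

text \<open>The interaction times live on the same space as \<open>W\<close>, so an integrand
  \<open>q (\<tau>\<^sub>1 \<omega>) (\<tau>\<^sub>2 \<omega>) \<omega>\<close> is not in Fubini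
  form on \<open>M\<close>. Independence gives a product law only for the pair of times together
  with \<omega> observed through the augmented sigma-algebra at T; hence all integrands are kept
  measurable for that sigma-algebra. For the same reason the indicator of a test event, which may
  depend on the times, is first replaced by its conditional expectation at time t.

  Null sets that depend on a time are the other obstacle. The chain rule for the Malliavin
  derivative has an exceptional set in (s, \<omega>) for each u, whereas conditioning at time s
  calls for one in (u, \<omega>) for almost every s. Tonelli converts one into the other.

  The integrability of the triple integral over s, u and \<omega> is not a separate assumption: it
  is transported from the integrability of the particle integrands, using that the density of the
  times is positive on the triangle.\<close>

subsection \<open>Integrals of conditional expectations\<close>

text \<open>The summands \<open>A j * D j\<close> need not be integrable separately, hence the localization to the
  sets on which all \<open>A j\<close> are bounded.\<close>

lemma (in sigma_finite_subalgebra) real_cond_exp_lincomb: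
  assumes J: "finite J"
    and A: "\<And>j. j \<in> J \<Longrightarrow> A j \<in> borel_measurable F"
    and D: "\<And>j. j \<in> J \<Longrightarrow> integrable M (D j)"
    and AD: "integrable M (\<lambda>\<omega>. \<Sum>j\<in>J. A j \<omega> * D j \<omega>)"
  shows "AE \<omega> in M. real_cond_exp M F (\<lambda>\<omega>. \<Sum>j\<in>J. A j \<omega> * D j \<omega>) \<omega>
           = (\<Sum>j\<in>J. A j \<omega> * real_cond_exp M F (D j) \<omega>)"
proof -
  \<comment> \<open>Extension by 0 makes measurability and integrability hold at every index, which
    is the form in which \<open>real_cond_exp_sum\<close> asks for them.\<close>
  define A' where "A' j = (if j \<in> J then A j else (\<lambda>_. 0))" for j
  define D' where "D' j = (if j \<in> J then D j else (\<lambda>_. 0))" for j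
  have A'[measurable]: "A' j \<in> borel_measurable F" for j using A by (auto simp: A'_def)
  have D'[measurable]: "integrable M (D' j)" for j using D by (auto simp: D'_def)
  have A'M[measurable]: "A' j \<in> borel_measurable M" for j
    using measurable_from_subalg[OF subalg A'] .
  let ?S = "\<lambda>\<omega>. \<Sum>j\<in>J. A' j \<omega> * D' j \<omega>"
  have S: "integrable M ?S" using AD by (simp add: A'_def D'_def cong: sum.cong)
  define B where "B n = {\<omega> \<in> space F. \<forall>j\<in>J. \<bar>A' j \<omega>\<bar> \<le> real n}" for n :: nat
  have spF: "space F = space M" using subalg by (simp add: subalgebra_def)
  have B[measurable]: "B n \<in> sets F" for n
    unfolding B_def using J by measurable
  have BM[measurable]: "B n \<in> sets M" for n using B subalg by (auto simp: subalgebra_def)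
  have 1: "AE \<omega> in M. real_cond_exp M F (\<lambda>\<omega>. indicator (B n) \<omega> * ?S \<omega>) \<omega>
              = indicator (B n) \<omega> * real_cond_exp M F ?S \<omega>" for n
    using integrable_mult_indicator[OF BM S] S by (intro real_cond_exp_mult) auto
  have intBj: "integrable M (\<lambda>\<omega>. (indicator (B n) \<omega> * A' j \<omega>) * D' j \<omega>)" if "j \<in> J" for n j
  proof (rule Bochner_Integration.integrable_bound[OF integrable_mult_right[OF D'[of j], of "real n"]])
    show "AE \<omega> in M. norm (indicat_real (B n) \<omega> * A' j \<omega> * D' j \<omega>) \<le> norm (real n * D' j \<omega>)"
      using that by (auto intro!: AE_I2 simp: B_def abs_mult indicator_def mult_right_mono)
  qed (use D' in measurable)
  have intB: "integrable M (\<lambda>\<omega>. if j \<in> J then (indicator (B n) \<omega> * A' j \<omega>) * D' j \<omega> else 0)" for n j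
    using intBj[of j n] by (cases "j \<in> J") auto
  have 2: "AE \<omega> in M. real_cond_exp M F (\<lambda>\<omega>. \<Sum>j\<in>J. if j \<in> J then (indicator (B n) \<omega> * A' j \<omega>) * D' j \<omega> else 0) \<omega>
              = (\<Sum>j\<in>J. real_cond_exp M F (\<lambda>\<omega>. if j \<in> J then (indicator (B n) \<omega> * A' j \<omega>) * D' j \<omega> else 0) \<omega>)" for n
    by (rule real_cond_exp_sum[OF intB])
  have 3: "AE \<omega> in M. real_cond_exp M F (\<lambda>\<omega>. (indicator (B n) \<omega> * A' j \<omega>) * D' j \<omega>) \<omega>
              = (indicator (B n) \<omega> * A' j \<omega>) * real_cond_exp M F (D' j) \<omega>" if "j \<in> J" for n j
    using intBj[OF that, of n] D' by (intro real_cond_exp_mult) auto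
  have 3: "AE \<omega> in M. \<forall>j\<in>J. real_cond_exp M F (\<lambda>\<omega>. (indicator (B n) \<omega> * A' j \<omega>) * D' j \<omega>) \<omega>
              = (indicator (B n) \<omega> * A' j \<omega>) * real_cond_exp M F (D' j) \<omega>" for n
    using J 3 by (simp add: AE_finite_all)
  have eq: "(\<lambda>\<omega>. \<Sum>j\<in>J. if j \<in> J then (indicator (B n) \<omega> * A' j \<omega>) * D' j \<omega> else 0)
           = (\<lambda>\<omega>. indicator (B n) \<omega> * ?S \<omega>)" for n
    by (simp add: sum_distrib_left mult.assoc cong: sum.cong)
  have "AE \<omega> in M. \<forall>n. indicator (B n) \<omega> * real_cond_exp M F ?S \<omega>
              = indicator (B n) \<omega> * (\<Sum>j\<in>J. A' j \<omega> * real_cond_exp M F (D' j) \<omega>)"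
  proof (subst AE_all_countable, rule allI)
    fix n
    show "AE \<omega> in M. indicator (B n) \<omega> * real_cond_exp M F ?S \<omega>
              = indicator (B n) \<omega> * (\<Sum>j\<in>J. A' j \<omega> * real_cond_exp M F (D' j) \<omega>)"
      using 1[of n] 2[of n, unfolded eq] 3[of n]
    proof eventually_elim
      case (elim \<omega>)
      then show ?case by (simp add: sum_distrib_left mult.assoc cong: sum.cong)
    qed
  qed
  then have "AE \<omega> in M. real_cond_exp M F ?S \<omega> = (\<Sum>j\<in>J. A' j \<omega> * real_cond_exp M F (D' j) \<omega>)"
  proof (rule AE_mp, intro AE_I2 impI)
    fix \<omega> assume \<omega>: "\<omega> \<in> space M" and *: "\<forall>n. indicator (B n) \<omega> * real_cond_exp M F ?S \<omega>
              = indicator (B n) \<omega> * (\<Sum>j\<in>J. A' j \<omega> * real_cond_exp M F (D' j) \<omega>)"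
    \<comment> \<open>The sets \<open>B n\<close> exhaust the space: a bound for the finite sum
      bounds every \<open>A' j\<close> at this point.\<close>
    obtain n where n: "(\<Sum>j\<in>J. \<bar>A' j \<omega>\<bar>) \<le> real n" using real_arch_simple by blast
    have "\<bar>A' j \<omega>\<bar> \<le> real n" if "j \<in> J" for j
      using member_le_sum[OF that _ J, of "\<lambda>j. \<bar>A' j \<omega>\<bar>"] n by simp
    then have "\<omega> \<in> B n" using \<omega> by (auto simp: B_def spF)
    then show "real_cond_exp M F ?S \<omega> = (\<Sum>j\<in>J. A' j \<omega> * real_cond_exp M F (D' j) \<omega>)"
      using *[rule_format, of n] by simp
  qed
  then show ?thesis by (simp add: A'_def D'_def cong: sum.cong)
qed

text \<open>Contraction in L1, in terms of nonnegative integrals so that it applies to every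
  measurable slice and can itself be used to establish integrability.\<close>

lemma (in sigma_finite_subalgebra) nn_integral_real_cond_exp_le:
  assumes [measurable]: "g \<in> borel_measurable M"
  shows "(\<integral>\<^sup>+\<omega>. ennreal \<bar>real_cond_exp M F g \<omega>\<bar> \<partial>M) \<le> (\<integral>\<^sup>+\<omega>. ennreal \<bar>g \<omega>\<bar> \<partial>M)"
proof -
  have "(\<integral>\<^sup>+\<omega>. ennreal \<bar>real_cond_exp M F g \<omega>\<bar> \<partial>M) \<le> (\<integral>\<^sup>+\<omega>. nn_cond_exp M F (\<lambda>\<omega>. ennreal \<bar>g \<omega>\<bar>) \<omega> \<partial>M)"
    by (intro nn_integral_mono_AE real_cond_exp_abs) simp
  also have "\<dots> = (\<integral>\<^sup>+\<omega>. ennreal \<bar>g \<omega>\<bar> \<partial>M)"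
    using nn_cond_exp_intg[of "\<lambda>_. 1" "\<lambda>\<omega>. ennreal \<bar>g \<omega>\<bar>"] by simp
  finally show ?thesis .
qed

text \<open>Tonelli reduces the claim to slices in \<open>u\<close>, where the L1 contraction
  applies. This provides the Fubini hypothesis for a version \<open>C\<close> that is tied to the
  conditional expectations only for almost every \<open>u\<close>.\<close>

lemma (in sigma_finite_subalgebra) integrable_joint_cond_exp:
  assumes C[measurable]: "(\<lambda>(u, \<omega>). C u \<omega>) \<in> borel_measurable (lborel \<Otimes>\<^sub>M M)"
    and g: "integrable (lborel \<Otimes>\<^sub>M M) (\<lambda>(u, \<omega>). indicator {s..T::real} u * g u \<omega> :: real)"
    and Cg: "AE u in lborel. u \<in> {s..T} \<longrightarrow> (AE \<omega> in M. C u \<omega> = real_cond_exp M F (g u) \<omega>)"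
  shows "integrable (lborel \<Otimes>\<^sub>M M) (\<lambda>(u, \<omega>). indicator {s..T} u * C u \<omega> :: real)"
proof (rule integrableI_bounded)
  have gm[measurable]: "(\<lambda>(u, \<omega>). indicator {s..T} u * g u \<omega>) \<in> borel_measurable (lborel \<Otimes>\<^sub>M M)"
    using g by blast
  have gu: "g u \<in> borel_measurable M" if "u \<in> {s..T}" for u
  proof -
    have "(\<lambda>\<omega>. (\<lambda>(u, \<omega>). indicator {s..T} u * g u \<omega>) (u, \<omega>)) \<in> borel_measurable M"
      by (rule measurable_Pair2[OF gm]) simp
    moreover have "indicator {s..T} u = (1::real)" using that by simp
    ultimately show ?thesis by simp
  qed
  have "(\<integral>\<^sup>+x. norm (case x of (u, \<omega>) \<Rightarrow> indicator {s..T} u * C u \<omega>) \<partial>(lborel \<Otimes>\<^sub>M M))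
     = (\<integral>\<^sup>+u. \<integral>\<^sup>+\<omega>. norm (indicator {s..T} u * C u \<omega>) \<partial>M \<partial>lborel)"
    by (subst nn_integral_fst[symmetric]) auto
  also have "\<dots> \<le> (\<integral>\<^sup>+u. \<integral>\<^sup>+\<omega>. norm (indicator {s..T} u * g u \<omega>) \<partial>M \<partial>lborel)"
  proof (rule nn_integral_mono_AE, use Cg in eventually_elim)
    fix u assume u: "u \<in> {s..T} \<longrightarrow> (AE \<omega> in M. C u \<omega> = real_cond_exp M F (g u) \<omega>)"
    show "(\<integral>\<^sup>+\<omega>. norm (indicator {s..T} u * C u \<omega>) \<partial>M) \<le> (\<integral>\<^sup>+\<omega>. norm (indicator {s..T} u * g u \<omega>) \<partial>M)"
    proof (cases "u \<in> {s..T}")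
      case True
      have "(\<integral>\<^sup>+\<omega>. norm (indicator {s..T} u * C u \<omega>) \<partial>M) = (\<integral>\<^sup>+\<omega>. \<bar>real_cond_exp M F (g u) \<omega>\<bar> \<partial>M)"
        using u True by (intro nn_integral_cong_AE) auto
      also have "\<dots> \<le> (\<integral>\<^sup>+\<omega>. \<bar>g u \<omega>\<bar> \<partial>M)"
        by (rule nn_integral_real_cond_exp_le) (use gu True in auto)
      finally show ?thesis using True by simp
    qed simp
  qed
  also have "\<dots> = (\<integral>\<^sup>+x. norm (case x of (u, \<omega>) \<Rightarrow> indicator {s..T} u * g u \<omega>) \<partial>(lborel \<Otimes>\<^sub>M M))"
    by (subst nn_integral_fst[symmetric]) auto
  also have "\<dots> < \<infinity>" using g by (simp add: integrable_iff_bounded)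
  finally show "(\<integral>\<^sup>+x. norm (case x of (u, \<omega>) \<Rightarrow> indicator {s..T} u * C u \<omega>) \<partial>(lborel \<Otimes>\<^sub>M M)) < \<infinity>" .
qed measurable

text \<open>The weights \<open>A j\<close> are known to \<open>F\<close>, so they pass through the
  conditional expectation for almost every \<open>u\<close>, and Fubini does the rest. The pair
  \<open>K\<close>, \<open>K'\<close> abstracts the self-adjointness of conditional expectation, so
  that the lemma serves two purposes: with \<open>K' = K\<close> measurable for \<open>F\<close>,
  and with \<open>K\<close> arbitrary and \<open>K'\<close> its conditional expectation.\<close>

lemma (in sigma_finite_subalgebra) integral_of_cond_exp_lincomb:
  fixes s T :: real
  assumes J: "finite J"
    and A: "\<And>j. j \<in> J \<Longrightarrow> A j \<in> borel_measurable F"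
    and R: "\<And>j. j \<in> J \<Longrightarrow> is_integral_of_cond_exp M F s T (b j) (R j)"
    and q: "integrable (lborel \<Otimes>\<^sub>M M) (\<lambda>(u, \<omega>). indicator {s..T} u * (\<Sum>j\<in>J. A j \<omega> * b j u \<omega>))"
    and K[measurable]: "K \<in> borel_measurable M" "K' \<in> borel_measurable M"
    and Kb: "\<And>\<omega>. \<bar>K \<omega>\<bar> \<le> k" "\<And>\<omega>. \<bar>K' \<omega>\<bar> \<le> k"
    and Sm[measurable]: "(\<lambda>\<omega>. \<Sum>j\<in>J. A j \<omega> * R j \<omega>) \<in> borel_measurable M"
    and KK': "\<And>h. integrable M h \<Longrightarrow> (LINT \<omega>|M. K \<omega> * real_cond_exp M F h \<omega>) = (LINT \<omega>|M. K' \<omega> * h \<omega>)"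
  shows "integrable M (\<lambda>\<omega>. \<Sum>j\<in>J. A j \<omega> * R j \<omega>)" (is ?int)
    and "(LINT \<omega>|M. K \<omega> * (\<Sum>j\<in>J. A j \<omega> * R j \<omega>))
      = (LINT (u, \<omega>)|(lborel \<Otimes>\<^sub>M M). K' \<omega> * (indicator {s..T} u * (\<Sum>j\<in>J. A j \<omega> * b j u \<omega>)))" (is ?eq)
proof -
  interpret L: pair_sigma_finite lborel M ..
  have "\<exists>C. \<forall>j\<in>J. (\<lambda>(u, \<omega>). C j u \<omega>) \<in> borel_measurable (lborel \<Otimes>\<^sub>M M) \<and>
        (AE u in lborel. u \<in> {s..T} \<longrightarrow> (AE \<omega> in M. C j u \<omega> = real_cond_exp M F (b j u) \<omega>)) \<and>
        (AE \<omega> in M. R j \<omega> = (LINT u:{s..T}|lborel. C j u \<omega>))"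
    using R unfolding is_integral_of_cond_exp_def by (intro bchoice) auto
  then obtain C where Cm: "\<And>j. j \<in> J \<Longrightarrow> (\<lambda>(u, \<omega>). C j u \<omega>) \<in> borel_measurable (lborel \<Otimes>\<^sub>M M)"
    and Cb: "\<And>j. j \<in> J \<Longrightarrow> AE u in lborel. u \<in> {s..T} \<longrightarrow> (AE \<omega> in M. C j u \<omega> = real_cond_exp M F (b j u) \<omega>)"
    and CR: "\<And>j. j \<in> J \<Longrightarrow> AE \<omega> in M. R j \<omega> = (LINT u:{s..T}|lborel. C j u \<omega>)"
    by blast
  have b: "integrable (lborel \<Otimes>\<^sub>M M) (\<lambda>(u, \<omega>). indicator {s..T} u * b j u \<omega>)" if "j \<in> J" for j
    using R[OF that] by (simp add: is_integral_of_cond_exp_def)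
  have AM: "A j \<in> borel_measurable M" if "j \<in> J" for j
    using measurable_from_subalg[OF subalg A[OF that]] .
  have Ci: "integrable (lborel \<Otimes>\<^sub>M M) (\<lambda>(u, \<omega>). indicator {s..T} u * C j u \<omega>)" if "j \<in> J" for j
    by (rule integrable_joint_cond_exp[OF Cm b Cb]) (use that in auto)
  \<comment> \<open>\<open>c u\<close> will be a version of the conditional expectation of
    \<open>p u\<close>. Only these two sums, not their summands, are integrable jointly in (u,
    \<omega>).\<close>
  define c where "c u \<omega> = (\<Sum>j\<in>J. A j \<omega> * C j u \<omega>)" for u \<omega>
  define p where "p u \<omega> = (\<Sum>j\<in>J. A j \<omega> * b j u \<omega>)" for u \<omega>
  have AM2: "(\<lambda>(u, \<omega>). A j \<omega>) \<in> borel_measurable (lborel \<Otimes>\<^sub>M M)" if "j \<in> J" for j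
    using AM[OF that] by measurable
  have cm: "(\<lambda>(u, \<omega>). c u \<omega>) \<in> borel_measurable (lborel \<Otimes>\<^sub>M M)"
    using borel_measurable_sum[of J "\<lambda>j x. (case x of (u, \<omega>) \<Rightarrow> A j \<omega>) * (case x of (u, \<omega>) \<Rightarrow> C j u \<omega>)" "lborel \<Otimes>\<^sub>M M"]
      borel_measurable_times[OF AM2 Cm] by (simp add: c_def case_prod_beta')
  have bu: "AE u in lborel. \<forall>j\<in>J. integrable M (\<lambda>\<omega>. indicator {s..T} u * b j u \<omega>)"
    by (rule AE_finite_allI[OF J L.AE_integrable_fst[OF b]])
  have pu: "AE u in lborel. integrable M (\<lambda>\<omega>. indicator {s..T} u * p u \<omega>)"
    using L.AE_integrable_fst[OF q] by (simp add: p_def)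
  have Cb': "AE u in lborel. \<forall>j\<in>J. u \<in> {s..T} \<longrightarrow> (AE \<omega> in M. C j u \<omega> = real_cond_exp M F (b j u) \<omega>)"
    by (rule AE_finite_allI[OF J Cb])
  have cp: "AE u in lborel. u \<in> {s..T} \<longrightarrow> (AE \<omega> in M. c u \<omega> = real_cond_exp M F (p u) \<omega>)"
    using bu pu Cb'
  proof (eventually_elim, intro impI)
    fix u assume u: "u \<in> {s..T}"
      and 1: "\<forall>j\<in>J. integrable M (\<lambda>\<omega>. indicator {s..T} u * b j u \<omega>)"
      and 2: "integrable M (\<lambda>\<omega>. indicator {s..T} u * p u \<omega>)"
      and 3: "\<forall>j\<in>J. u \<in> {s..T} \<longrightarrow> (AE \<omega> in M. C j u \<omega> = real_cond_exp M F (b j u) \<omega>)"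
    from 3 u J have "AE \<omega> in M. \<forall>j\<in>J. C j u \<omega> = real_cond_exp M F (b j u) \<omega>" by (simp add: AE_finite_all)
    moreover have "AE \<omega> in M. real_cond_exp M F (\<lambda>\<omega>. \<Sum>j\<in>J. A j \<omega> * b j u \<omega>) \<omega>
           = (\<Sum>j\<in>J. A j \<omega> * real_cond_exp M F (b j u) \<omega>)"
      by (rule real_cond_exp_lincomb[OF J A]) (use 1 2 u in \<open>auto simp: p_def\<close>)
    ultimately show "AE \<omega> in M. c u \<omega> = real_cond_exp M F (p u) \<omega>"
      by eventually_elim (simp add: c_def p_def[abs_def])
  qed
  have q': "integrable (lborel \<Otimes>\<^sub>M M) (\<lambda>(u, \<omega>). indicator {s..T} u * p u \<omega>)"
    using q by (simp add: p_def)
  have ci: "integrable (lborel \<Otimes>\<^sub>M M) (\<lambda>(u, \<omega>). indicator {s..T} u * c u \<omega>)"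
    by (rule integrable_joint_cond_exp[OF cm q' cp])
  \<comment> \<open>Along a single path the weights are constants in \<open>u\<close>, so here the
    integral of the sum may be split although the weighted summands are not jointly
    integrable.\<close>
  have Cw: "AE \<omega> in M. \<forall>j\<in>J. integrable lborel (\<lambda>u. indicator {s..T} u * C j u \<omega>)"
    using J L.AE_integrable_snd[OF Ci] by (simp add: AE_finite_all)
  have CR': "AE \<omega> in M. \<forall>j\<in>J. R j \<omega> = (LINT u:{s..T}|lborel. C j u \<omega>)"
    using J CR by (simp add: AE_finite_all)
  have S: "AE \<omega> in M. (\<Sum>j\<in>J. A j \<omega> * R j \<omega>) = (LINT u|lborel. indicator {s..T} u * c u \<omega>)"
    using Cw CR'
  proof eventually_elim
    case (elim \<omega>)
    have "(LINT u|lborel. indicator {s..T} u * c u \<omega>)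
        = (LINT u|lborel. (\<Sum>j\<in>J. A j \<omega> * (indicator {s..T} u * C j u \<omega>)))"
      by (simp add: c_def sum_distrib_left mult_ac)
    also have "\<dots> = (\<Sum>j\<in>J. (LINT u|lborel. A j \<omega> * (indicator {s..T} u * C j u \<omega>)))"
      by (rule Bochner_Integration.integral_sum) (use elim in auto)
    also have "\<dots> = (\<Sum>j\<in>J. A j \<omega> * R j \<omega>)"
      using elim by (intro sum.cong refl) (simp add: set_lebesgue_integral_def)
    finally show ?case by simp
  qed
  have ci_int: "integrable M (\<lambda>\<omega>. LINT u|lborel. indicator {s..T} u * c u \<omega>)"
    using L.integrable_snd[OF ci] .
  then show ?int
    by (rule integrable_cong_AE_imp) (use S in auto)
  have ciK: "integrable (lborel \<Otimes>\<^sub>M M) (\<lambda>(u, \<omega>). K \<omega> * (indicator {s..T} u * c u \<omega>))"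
  proof (rule Bochner_Integration.integrable_bound[OF integrable_mult_right[OF ci, of k]])
    show "(\<lambda>(u, \<omega>). K \<omega> * (indicator {s..T} u * c u \<omega>)) \<in> borel_measurable (lborel \<Otimes>\<^sub>M M)"
      using cm by measurable
  qed (use Kb in \<open>auto simp: abs_mult intro!: AE_I2 mult_mono order_trans[OF Kb(1)]\<close>)
  have pm: "(\<lambda>(u, \<omega>). indicator {s..T} u * p u \<omega>) \<in> borel_measurable (lborel \<Otimes>\<^sub>M M)"
    using q' by blast
  have piK: "integrable (lborel \<Otimes>\<^sub>M M) (\<lambda>(u, \<omega>). K' \<omega> * (indicator {s..T} u * p u \<omega>))"
  proof (rule Bochner_Integration.integrable_bound[OF integrable_mult_right[OF q', of k]])
    show "(\<lambda>(u, \<omega>). K' \<omega> * (indicator {s..T} u * p u \<omega>)) \<in> borel_measurable (lborel \<Otimes>\<^sub>M M)"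
      using pm by measurable
  qed (use Kb in \<open>auto simp: abs_mult intro!: AE_I2 mult_mono order_trans[OF Kb(2)]\<close>)
  have "(LINT \<omega>|M. K \<omega> * (\<Sum>j\<in>J. A j \<omega> * R j \<omega>))
      = (LINT \<omega>|M. K \<omega> * (LINT u|lborel. indicator {s..T} u * c u \<omega>))"
    using ci_int by (intro integral_cong_AE) (use S in auto)
  also have "\<dots> = (LINT \<omega>|M. LINT u|lborel. K \<omega> * (indicator {s..T} u * c u \<omega>))"
    by simp
  also have "\<dots> = (LINT u|lborel. LINT \<omega>|M. K \<omega> * (indicator {s..T} u * c u \<omega>))"
    by (rule L.Fubini_integral[OF ciK])
  also have "\<dots> = (LINT u|lborel. LINT \<omega>|M. K' \<omega> * (indicator {s..T} u * p u \<omega>))"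
  proof (rule integral_cong_AE)
    show "(\<lambda>u. LINT \<omega>|M. K \<omega> * (indicator {s..T} u * c u \<omega>)) \<in> borel_measurable lborel"
      using L.integrable_fst[OF ciK] by blast
    show "(\<lambda>u. LINT \<omega>|M. K' \<omega> * (indicator {s..T} u * p u \<omega>)) \<in> borel_measurable lborel"
      using L.integrable_fst[OF piK] by blast
    show "AE u in lborel. (LINT \<omega>|M. K \<omega> * (indicator {s..T} u * c u \<omega>))
        = (LINT \<omega>|M. K' \<omega> * (indicator {s..T} u * p u \<omega>))"
      using cp pu
    proof eventually_elim
      fix u assume 1: "u \<in> {s..T} \<longrightarrow> (AE \<omega> in M. c u \<omega> = real_cond_exp M F (p u) \<omega>)"
        and 2: "integrable M (\<lambda>\<omega>. indicator {s..T} u * p u \<omega>)"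
      show "(LINT \<omega>|M. K \<omega> * (indicator {s..T} u * c u \<omega>))
        = (LINT \<omega>|M. K' \<omega> * (indicator {s..T} u * p u \<omega>))"
      proof (cases "u \<in> {s..T}")
        case True
        have [measurable]: "c u \<in> borel_measurable M"
          using measurable_Pair2[OF cm, of u] by simp
        have "(LINT \<omega>|M. K \<omega> * c u \<omega>) = (LINT \<omega>|M. K \<omega> * real_cond_exp M F (p u) \<omega>)"
          using 1 True by (intro integral_cong_AE) auto
        also have "\<dots> = (LINT \<omega>|M. K' \<omega> * p u \<omega>)"
          using 2 True by (intro KK') simp
        finally show ?thesis using True by simp
      qed simp
    qed
  qed
  also have "\<dots> = (LINT (u, \<omega>)|(lborel \<Otimes>\<^sub>M M). K' \<omega> * (indicator {s..T} u * p u \<omega>))"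
    by (rule L.integral_fst[OF piK])
  finally show ?eq by (simp add: p_def)
qed

text \<open>Conditional expectation is self-adjoint, so it can be moved from \<open>h\<close> to the
  indicator of \<open>B\<close>. The resulting weight is measurable for \<open>F\<close> even when
  \<open>B\<close> is not in \<open>F\<close>.\<close>

lemma (in finite_measure_subalgebra) cond_exp_indicator_dual:
  assumes B[measurable]: "B \<in> sets M"
  obtains K where "K \<in> borel_measurable F" "\<And>\<omega>. 0 \<le> K \<omega>" "\<And>\<omega>. K \<omega> \<le> 1"
    "\<And>h. integrable M h \<Longrightarrow> (LINT \<omega>|M. indicator B \<omega> * real_cond_exp M F h \<omega>) = (LINT \<omega>|M. K \<omega> * h \<omega>)"
proof
  let ?E = "real_cond_exp M F (indicator B)"
  \<comment> \<open>Clipping to [0, 1] changes the conditional expectation only on a null set and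
    turns its almost sure bounds into pointwise ones.\<close>
  define K where "K \<omega> = min 1 (max 0 (?E \<omega>))" for \<omega>
  show K[measurable]: "K \<in> borel_measurable F" by (simp add: K_def[abs_def])
  have KM[measurable]: "K \<in> borel_measurable M" by (rule measurable_from_subalg[OF subalg K])
  show K0: "0 \<le> K \<omega>" and K1: "K \<omega> \<le> 1" for \<omega> by (auto simp: K_def)
  fix h :: "'a \<Rightarrow> real" assume h: "integrable M h"
  have iB: "integrable M (indicator B :: 'a \<Rightarrow> real)"
    by (simp add: emeasure_eq_measure)
  have "AE \<omega> in M. 0 \<le> ?E \<omega>"
    by (rule real_cond_exp_pos) auto
  moreover have "AE \<omega> in M. ?E \<omega> \<le> 1"
    by (rule real_cond_exp_le_c[OF iB]) (auto simp: indicator_def)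
  ultimately have KE: "AE \<omega> in M. K \<omega> = ?E \<omega>" by eventually_elim (simp add: K_def)
  have Eh: "integrable M (real_cond_exp M F h)" using h by (rule real_cond_exp_int)
  have "(LINT \<omega>|M. indicator B \<omega> * real_cond_exp M F h \<omega>) = (LINT \<omega>|M. real_cond_exp M F h \<omega> * indicator B \<omega>)"
    by (simp add: mult.commute)
  also have "\<dots> = (LINT \<omega>|M. real_cond_exp M F h \<omega> * ?E \<omega>)"
    by (rule real_cond_exp_intg(2)[symmetric])
      (use integrable_mult_indicator[OF B Eh] in \<open>auto simp: mult.commute\<close>)
  also have "\<dots> = (LINT \<omega>|M. K \<omega> * real_cond_exp M F h \<omega>)"
    by (rule integral_cong_AE) (use KE in auto)
  also have "\<dots> = (LINT \<omega>|M. K \<omega> * h \<omega>)"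
  proof (rule real_cond_exp_intg(2))
    show "integrable M (\<lambda>\<omega>. K \<omega> * h \<omega>)"
      by (rule Bochner_Integration.integrable_bound[OF h])
        (use h K0 K1 in \<open>auto simp: abs_mult intro!: AE_I2 mult_left_le_one_le\<close>)
  qed (use h in auto)
  finally show "(LINT \<omega>|M. indicator B \<omega> * real_cond_exp M F h \<omega>) = (LINT \<omega>|M. K \<omega> * h \<omega>)" .
qed

text \<open>In the application \<open>K\<close> is the indicator of an arbitrary event of \<open>M\<close> and \<open>K'\<close> its conditional
  expectation: testing against all of \<open>M\<close> is necessary because \<open>V\<close> is not known to be
  \<open>F t\<close>-measurable.\<close>

lemma iterated_integral_of_cond_exp:
  fixes t T :: real and q :: "real \<Rightarrow> real \<Rightarrow> 'a \<Rightarrow> real"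
  assumes M: "finite_measure M" and tT: "t \<le> T" and J: "finite J"
    and F: "\<And>s. s \<in> {t..T} \<Longrightarrow> subalgebra M (F s)" "\<And>s. s \<in> {t..T} \<Longrightarrow> subalgebra (F s) (F t)"
    and A: "\<And>j s. j \<in> J \<Longrightarrow> s \<in> {t..T} \<Longrightarrow> A j s \<in> borel_measurable (F s)"
    and R: "AE s in lborel. s \<in> {t..T} \<longrightarrow> (\<forall>j\<in>J. is_integral_of_cond_exp M (F s) s T (b j s) (R j s))"
    and V: "is_integral_of_cond_exp M (F t) t T (\<lambda>s \<omega>. \<Sum>j\<in>J. A j s \<omega> * R j s \<omega>) V"
    and V_meas: "V \<in> borel_measurable M"
    and q: "integrable (lborel \<Otimes>\<^sub>M (lborel \<Otimes>\<^sub>M M)) (\<lambda>(s, u, \<omega>). q s u \<omega>)"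
    and q_eq: "AE s in lborel. AE (u, \<omega>) in lborel \<Otimes>\<^sub>M M.
        q s u \<omega> = indicator {t..T} s * (indicator {s..T} u * (\<Sum>j\<in>J. A j s \<omega> * b j s u \<omega>))"
    and K: "K \<in> borel_measurable M" "K' \<in> borel_measurable (F t)"
    and Kb: "\<And>\<omega>. \<bar>K \<omega>\<bar> \<le> k" "\<And>\<omega>. \<bar>K' \<omega>\<bar> \<le> k"
    and KK': "\<And>h. integrable M h \<Longrightarrow> (LINT \<omega>|M. K \<omega> * real_cond_exp M (F t) h \<omega>) = (LINT \<omega>|M. K' \<omega> * h \<omega>)"
  shows "integrable M V"
    and "(LINT \<omega>|M. K \<omega> * V \<omega>) = (LINT (s, u, \<omega>)|(lborel \<Otimes>\<^sub>M (lborel \<Otimes>\<^sub>M M)). K' \<omega> * q s u \<omega>)"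
proof -
  interpret finite_measure M by fact
  interpret L: pair_sigma_finite lborel M ..
  interpret LL: pair_sigma_finite lborel "lborel \<Otimes>\<^sub>M M" ..
  interpret Ft: finite_measure_subalgebra M "F t" by standard (use F tT in auto)
  let ?g = "\<lambda>s \<omega>. \<Sum>j\<in>J. A j s \<omega> * R j s \<omega>"
  have K'M[measurable]: "K' \<in> borel_measurable M" by (rule measurable_from_subalg[OF Ft.subalg K(2)])
  have g: "integrable (lborel \<Otimes>\<^sub>M M) (\<lambda>(s, \<omega>). indicator {t..T} s * ?g s \<omega>)"
    using V by (simp add: is_integral_of_cond_exp_def)
  then have gm: "(\<lambda>(s, \<omega>). indicator {t..T} s * ?g s \<omega>) \<in> borel_measurable (lborel \<Otimes>\<^sub>M M)" by blast
  have gs: "?g s \<in> borel_measurable M" if "s \<in> {t..T}" for s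
  proof -
    have "(\<lambda>\<omega>. indicator {t..T} s * ?g s \<omega>) \<in> borel_measurable M"
      using measurable_Pair2[OF gm, of s] by simp
    moreover have "indicator {t..T} s = (1::real)" using that by simp
    ultimately show ?thesis by simp
  qed
  have gK: "integrable (lborel \<Otimes>\<^sub>M M) (\<lambda>(s, \<omega>). K' \<omega> * (indicator {t..T} s * ?g s \<omega>))"
  proof (rule Bochner_Integration.integrable_bound[OF integrable_mult_right[OF g, of k]])
    show "(\<lambda>(s, \<omega>). K' \<omega> * (indicator {t..T} s * ?g s \<omega>)) \<in> borel_measurable (lborel \<Otimes>\<^sub>M M)"
      using gm by measurable
  qed (use Kb in \<open>auto simp: abs_mult intro!: AE_I2 mult_mono order_trans[OF Kb(2)]\<close>)
  have qm[measurable]: "(\<lambda>(s, u, \<omega>). q s u \<omega>) \<in> borel_measurable (lborel \<Otimes>\<^sub>M (lborel \<Otimes>\<^sub>M M))"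
    using q by blast
  have qK: "integrable (lborel \<Otimes>\<^sub>M (lborel \<Otimes>\<^sub>M M)) (\<lambda>(s, u, \<omega>). K' \<omega> * q s u \<omega>)"
  proof (rule Bochner_Integration.integrable_bound[OF integrable_mult_right[OF q, of k]])
    have "(\<lambda>p. K' (snd (snd p)) * (\<lambda>(s, u, \<omega>). q s u \<omega>) p) \<in> borel_measurable (lborel \<Otimes>\<^sub>M (lborel \<Otimes>\<^sub>M M))"
      by measurable
    then show "(\<lambda>(s, u, \<omega>). K' \<omega> * q s u \<omega>) \<in> borel_measurable (lborel \<Otimes>\<^sub>M (lborel \<Otimes>\<^sub>M M))"
      by (simp add: case_prod_beta')
  qed (use Kb in \<open>auto simp: abs_mult intro!: AE_I2 mult_mono order_trans[OF Kb(2)]\<close>)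
  \<comment> \<open>The outer time integral has a single summand with weight 1; here
    \<open>K\<close> is moved from \<open>V\<close> onto the integrand as \<open>K'\<close>.\<close>
  have outer: "integrable M V"
    "(LINT \<omega>|M. K \<omega> * V \<omega>) = (LINT (s, \<omega>)|(lborel \<Otimes>\<^sub>M M). K' \<omega> * (indicator {t..T} s * ?g s \<omega>))"
    using Ft.integral_of_cond_exp_lincomb[of "{()}" "\<lambda>_ _. 1" t T "\<lambda>_. ?g" "\<lambda>_. V" K K' k] V g K V_meas Kb KK'
    by simp_all
  show "integrable M V" by fact
  note outer(2)
  also have "(LINT (s, \<omega>)|(lborel \<Otimes>\<^sub>M M). K' \<omega> * (indicator {t..T} s * ?g s \<omega>))
      = (LINT s|lborel. LINT \<omega>|M. K' \<omega> * (indicator {t..T} s * ?g s \<omega>))"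
    by (rule L.integral_fst[OF gK, symmetric])
  also have "\<dots> = (LINT s|lborel. LINT (u, \<omega>)|(lborel \<Otimes>\<^sub>M M). K' \<omega> * q s u \<omega>)"
  proof (rule integral_cong_AE)
    show "(\<lambda>s. LINT \<omega>|M. K' \<omega> * (indicator {t..T} s * ?g s \<omega>)) \<in> borel_measurable lborel"
      using L.integrable_fst[OF gK] by blast
    have "(\<lambda>s. LINT p|(lborel \<Otimes>\<^sub>M M). (case (s, p) of (s, u, \<omega>) \<Rightarrow> K' \<omega> * q s u \<omega>)) \<in> borel_measurable lborel"
      using LL.integrable_fst'[OF qK] by blast
    then show "(\<lambda>s. LINT (u, \<omega>)|(lborel \<Otimes>\<^sub>M M). K' \<omega> * q s u \<omega>) \<in> borel_measurable lborel"
      by simp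
    show "AE s in lborel. (LINT \<omega>|M. K' \<omega> * (indicator {t..T} s * ?g s \<omega>))
        = (LINT (u, \<omega>)|(lborel \<Otimes>\<^sub>M M). K' \<omega> * q s u \<omega>)"
      using R q_eq LL.AE_integrable_fst'[OF q]
    proof eventually_elim
      fix s assume Rs: "s \<in> {t..T} \<longrightarrow> (\<forall>j\<in>J. is_integral_of_cond_exp M (F s) s T (b j s) (R j s))"
        and qs: "AE (u, \<omega>) in lborel \<Otimes>\<^sub>M M.
          q s u \<omega> = indicator {t..T} s * (indicator {s..T} u * (\<Sum>j\<in>J. A j s \<omega> * b j s u \<omega>))"
        and "integrable (lborel \<Otimes>\<^sub>M M) (\<lambda>y. case (s, y) of (s, u, \<omega>) \<Rightarrow> q s u \<omega>)"
      then have qsi: "integrable (lborel \<Otimes>\<^sub>M M) (\<lambda>(u, \<omega>). q s u \<omega>)" by simp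
      then have [measurable]: "(\<lambda>(u, \<omega>). q s u \<omega>) \<in> borel_measurable (lborel \<Otimes>\<^sub>M M)" by blast
      show "(LINT \<omega>|M. K' \<omega> * (indicator {t..T} s * ?g s \<omega>))
        = (LINT (u, \<omega>)|(lborel \<Otimes>\<^sub>M M). K' \<omega> * q s u \<omega>)"
      proof (cases "s \<in> {t..T}")
        case s: True
        interpret Fs: finite_measure_subalgebra M "F s" by standard (use F s in auto)
        let ?p = "\<lambda>(u, \<omega>). indicator {s..T} u * (\<Sum>j\<in>J. A j s \<omega> * b j s u \<omega>)"
        have pm[measurable]: "?p \<in> borel_measurable (lborel \<Otimes>\<^sub>M M)"
        proof -
          have "(\<lambda>(u, \<omega>). A j s \<omega> * (indicator {s..T} u * b j s u \<omega>)) \<in> borel_measurable (lborel \<Otimes>\<^sub>M M)" if "j \<in> J" for j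
          proof -
            have [measurable]: "A j s \<in> borel_measurable M"
              using measurable_from_subalg[OF Fs.subalg A[OF that s]] .
            have [measurable]: "(\<lambda>(u, \<omega>). indicator {s..T} u * b j s u \<omega>) \<in> borel_measurable (lborel \<Otimes>\<^sub>M M)"
              using Rs s that by (auto simp: is_integral_of_cond_exp_def)
            have "(\<lambda>x. A j s (snd x) * (case x of (u, \<omega>) \<Rightarrow> indicator {s..T} u * b j s u \<omega>)) \<in> borel_measurable (lborel \<Otimes>\<^sub>M M)"
              by measurable
            then show ?thesis by (simp add: case_prod_beta')
          qed
          from borel_measurable_sum[OF this]
          show ?thesis by (simp add: case_prod_beta' sum_distrib_left mult.left_commute)
        qed
        have qp: "AE x in lborel \<Otimes>\<^sub>M M. (case x of (u, \<omega>) \<Rightarrow> q s u \<omega>) = ?p x"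
          using qs by eventually_elim (use s in auto)
        have pint: "integrable (lborel \<Otimes>\<^sub>M M) ?p"
          by (rule integrable_cong_AE_imp[OF qsi pm]) (use qp in \<open>auto elim!: eventually_mono\<close>)
        \<comment> \<open>The tower property: information at time t is contained in that at time s,
          so \<open>K'\<close> is its own dual when conditioning at time s.\<close>
        have K's: "K' \<in> borel_measurable (F s)"
          using measurable_from_subalg[OF F(2)[OF s] K(2)] .
        have "(LINT \<omega>|M. K' \<omega> * ?g s \<omega>) = (LINT (u, \<omega>)|(lborel \<Otimes>\<^sub>M M). K' \<omega> * (indicator {s..T} u * (\<Sum>j\<in>J. A j s \<omega> * b j s u \<omega>)))"
        proof (rule Fs.integral_of_cond_exp_lincomb(2)[OF J, where k=k])
          fix h :: "'a \<Rightarrow> real" assume h: "integrable M h"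
          have "integrable M (\<lambda>\<omega>. K' \<omega> * h \<omega>)"
            by (rule Bochner_Integration.integrable_bound[OF integrable_mult_right[OF h, of k]])
              (use h Kb in \<open>auto simp: abs_mult intro!: AE_I2 mult_mono order_trans[OF Kb(2)]\<close>)
          then show "(LINT \<omega>|M. K' \<omega> * real_cond_exp M (F s) h \<omega>) = (LINT \<omega>|M. K' \<omega> * h \<omega>)"
            by (rule Fs.real_cond_exp_intg(2)) (use K's h in auto)
        qed (use A[OF _ s] Rs s pint K'M Kb gs in auto)
        also have "\<dots> = (LINT (u, \<omega>)|(lborel \<Otimes>\<^sub>M M). K' \<omega> * q s u \<omega>)"
        proof (rule integral_cong_AE)
          show "(\<lambda>(u, \<omega>). K' \<omega> * (indicator {s..T} u * (\<Sum>j\<in>J. A j s \<omega> * b j s u \<omega>))) \<in> borel_measurable (lborel \<Otimes>\<^sub>M M)"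
          proof -
            have "(\<lambda>x. K' (snd x) * ?p x) \<in> borel_measurable (lborel \<Otimes>\<^sub>M M)" by measurable
            then show ?thesis by (simp add: case_prod_beta')
          qed
        qed (use qp in \<open>auto elim!: eventually_mono\<close>)
        finally show ?thesis using s by simp
      next
        case False
        then have "AE x in lborel \<Otimes>\<^sub>M M. (case x of (u, \<omega>) \<Rightarrow> K' \<omega> * q s u \<omega>) = 0"
          using qs by (auto elim!: eventually_mono)
        then have "(LINT (u, \<omega>)|(lborel \<Otimes>\<^sub>M M). K' \<omega> * q s u \<omega>) = 0"
          by (rule integral_eq_zero_AE)
        then show ?thesis using False by simp
      qed
    qed
  qed
  also have "\<dots> = (LINT (s, u, \<omega>)|(lborel \<Otimes>\<^sub>M (lborel \<Otimes>\<^sub>M M)). K' \<omega> * q s u \<omega>)"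
    using LL.integral_fst'[OF qK] by simp
  finally show "(LINT \<omega>|M. K \<omega> * V \<omega>) = (LINT (s, u, \<omega>)|(lborel \<Otimes>\<^sub>M (lborel \<Otimes>\<^sub>M M)). K' \<omega> * q s u \<omega>)" .
qed

subsection \<open>The law of the interaction times\<close>

text \<open>The intensity is merely integrable, so its primitive \<open>P\<close> need not be differentiable;
  reparametrizing \<open>F\<close> by the values of \<open>P\<close> yields a function with derivative 0. This
  replaces the fundamental theorem of calculus for absolutely continuous functions.\<close>

lemma eq_if_increments_quadratic:
  fixes F P :: "real \<Rightarrow> real"
  assumes ab: "a \<le> b" and P: "continuous_on {a..b} P" "mono_on {a..b} P"
    and FP: "\<And>c d. a \<le> c \<Longrightarrow> c \<le> d \<Longrightarrow> d \<le> b \<Longrightarrow> \<bar>F d - F c\<bar> \<le> (P d - P c)\<^sup>2"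
  shows "F a = F b"
proof -
  have FP': "\<bar>F d - F c\<bar> \<le> (P d - P c)\<^sup>2" if "c \<in> {a..b}" "d \<in> {a..b}" for c d
    using FP[of c d] FP[of d c] that by (cases "c \<le> d") (auto simp: abs_minus_commute power2_commute)
  \<comment> \<open>A right inverse of \<open>P\<close> from the intermediate value theorem. The
    choice of preimage is immaterial, since \<open>FP\<close> makes \<open>F\<close> constant on the
    level sets of \<open>P\<close>.\<close>
  have "\<exists>\<phi>. \<forall>z\<in>{P a..P b}. \<phi> z \<in> {a..b} \<and> P (\<phi> z) = z"
    using IVT'[of P a _ b] ab P(1) by (intro bchoice) force
  then obtain \<phi> where \<phi>: "\<And>z. z \<in> {P a..P b} \<Longrightarrow> \<phi> z \<in> {a..b} \<and> P (\<phi> z) = z" by blast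
  define h where "h z = F (\<phi> z)" for z
  have h: "\<bar>h z - h w\<bar> \<le> (z - w)\<^sup>2" if "z \<in> {P a..P b}" "w \<in> {P a..P b}" for z w
    using FP'[of "\<phi> w" "\<phi> z"] \<phi>[OF that(1)] \<phi>[OF that(2)] by (simp add: h_def)
  have Pab: "P a \<le> P b" using P(2) ab by (auto simp: mono_on_def)
  have "(h has_derivative (\<lambda>_. 0)) (at z within {P a..P b})" if z: "z \<in> {P a..P b}" for z
  proof (rule has_derivativeI)
    show "((\<lambda>y. (h y - h z - 0) /\<^sub>R norm (y - z)) \<longlongrightarrow> 0) (at z within {P a..P b})"
    proof (rule Lim_null_comparison[of _ "\<lambda>y. \<bar>y - z\<bar>"])
      show "\<forall>\<^sub>F y in at z within {P a..P b}. norm ((h y - h z - 0) /\<^sub>R norm (y - z)) \<le> \<bar>y - z\<bar>"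
        unfolding eventually_at_filter
      proof (intro always_eventually allI impI)
        fix y assume "y \<noteq> z" "y \<in> {P a..P b}"
        then show "norm ((h y - h z - 0) /\<^sub>R norm (y - z)) \<le> \<bar>y - z\<bar>"
          using h[OF _ z, of y] by (simp add: divide_simps power2_eq_square flip: abs_mult)
      qed
      show "((\<lambda>y. \<bar>y - z\<bar>) \<longlongrightarrow> 0) (at z within {P a..P b})"
        by (rule tendsto_eq_intros refl | simp)+
    qed
  qed simp
  then obtain k where "\<And>z. z \<in> {P a..P b} \<Longrightarrow> h z = k"
    using has_derivative_zero_constant[of "{P a..P b}" h] by blast
  then have "h (P a) = h (P b)" using Pab by simp
  \<comment> \<open>The chosen preimage of \<open>P a\<close> may differ from \<open>a\<close>, but
    it has the same value of \<open>P\<close> and therefore of \<open>F\<close>.\<close>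
  moreover have "h (P a) = F a" "h (P b) = F b"
    using FP'[of a "\<phi> (P a)"] FP'[of b "\<phi> (P b)"] \<phi>[of "P a"] \<phi>[of "P b"] Pab ab by (auto simp: h_def)
  ultimately show ?thesis by simp
qed

text \<open>Integrability on the whole line is obtained in the application by cutting the given
  intensity off to 0 outside the interval from t to T; hence \<open>l\<close> is nonnegative rather
  than positive.\<close>

locale intensity =
  fixes l :: "real \<Rightarrow> real"
  assumes l_integrable[simp]: "integrable lborel l" and l_nonneg[simp]: "\<And>u. 0 \<le> l u"
begin

text \<open>Starting at minus infinity makes \<open>L\<close> the distribution function of the
  measure with density \<open>l\<close>, and its increments are the integrals of \<open>l\<close>
  without case distinctions on a base point.\<close>

definition L :: "real \<Rightarrow> real" where
  "L y = (LINT u:{..y}|lborel. l u)"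

lemma l_measurable[measurable]: "l \<in> borel_measurable borel"
  using borel_measurable_integrable[OF l_integrable] by simp

lemma l_set_integrable[simp]: "A \<in> sets borel \<Longrightarrow> set_integrable lborel A l"
  by (simp add: set_integrable_def integrable_mult_indicator[OF _ l_integrable, simplified])

lemma L_diff:
  assumes "x \<le> y" shows "(LINT u:{x..y}|lborel. l u) = L y - L x"
proof -
  have "L y = (LINT u:{..<x} \<union> {x..y}|lborel. l u)"
    using assms by (auto simp: L_def intro!: arg_cong2[where f="\<lambda>A f. set_lebesgue_integral lborel A f"])
  also have "\<dots> = (LINT u:{..<x}|lborel. l u) + (LINT u:{x..y}|lborel. l u)"
    by (rule set_integral_Un) auto
  also have "(LINT u:{..<x}|lborel. l u) = L x"
    unfolding L_def set_lebesgue_integral_def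
    by (rule integral_cong_AE)
      (use AE_lborel_singleton[of x] in \<open>auto elim!: eventually_mono split: split_indicator\<close>)
  finally show ?thesis by simp
qed

lemma L_mono: "x \<le> y \<Longrightarrow> L x \<le> L y"
  using L_diff[of x y] Bochner_Integration.integral_nonneg[of lborel "\<lambda>u. indicator {x..y} u * l u"]
  by (simp add: set_lebesgue_integral_def)

lemma L_measurable[measurable]: "L \<in> borel_measurable borel"
  by (rule borel_measurable_mono) (simp add: mono_def L_mono)

text \<open>A finite measure with a Lebesgue density has no atoms, so its distribution function is
  continuous.\<close>

lemma L_continuous: "continuous_on A L"
proof -
  let ?D = "density lborel l"
  have nn: "(\<integral>\<^sup>+u. l u \<partial>lborel) < \<infinity>"
    using nn_integral_eq_integral[OF l_integrable] by simp
  interpret D: finite_measure ?D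
    by (rule finite_measureI) (use nn in \<open>simp add: emeasure_density\<close>)
  interpret D: finite_borel_measure ?D by standard simp
  have L: "L = cdf ?D"
  proof
    fix y
    have "ennreal (L y) = (\<integral>\<^sup>+u. ennreal (indicator {..y} u * l u) \<partial>lborel)"
      unfolding L_def set_lebesgue_integral_def
      using l_set_integrable[of "{..y}"]
      by (subst nn_integral_eq_integral) (auto simp: set_integrable_def)
    also have "\<dots> = emeasure ?D {..y}"
      by (auto simp: emeasure_density intro!: nn_integral_cong split: split_indicator)
    finally have "ennreal (L y) = emeasure ?D {..y}" .
    moreover have "0 \<le> L y" unfolding L_def set_lebesgue_integral_def
      by (rule Bochner_Integration.integral_nonneg) simp
    ultimately show "L y = cdf ?D y"
      by (simp add: cdf_def D.emeasure_eq_measure)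
  qed
  have "emeasure ?D {x} = 0" for x
    by (subst emeasure_density) (auto simp: nn_integral_0_iff_AE intro!: AE_mp[OF AE_lborel_singleton[of x]] split: split_indicator)
  then have "isCont L x" for x
    unfolding L D.isCont_cdf by (simp add: measure_def)
  then show ?thesis by (simp add: continuous_at_imp_continuous_on)
qed

lemma l_exp_integrable: "set_integrable lborel {a..b} (\<lambda>u. l u * exp (c - L u))"
proof (rule set_integrable_bound)
  show "set_integrable lborel {a..b} (\<lambda>u. exp (c - L a) * l u)"
    by (rule set_integrable_mult_right) simp
  show "AE x in lborel. x \<in> {a..b} \<longrightarrow> norm (l x * exp (c - L x)) \<le> norm (exp (c - L a) * l x)"
    by (auto simp: abs_mult mult.commute L_mono intro!: AE_I2 mult_left_mono)
qed (simp add: set_borel_measurable_def)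

text \<open>The survival probability plus the accumulated density of an event time is conserved. Its
  increments are of second order in those of \<open>L\<close>, which makes it constant although
  \<open>L\<close> need not be differentiable.\<close>

lemma integral_l_exp:
  assumes ab: "a \<le> b"
  shows "(LINT u:{a..b}|lborel. l u * exp (c - L u)) = exp (c - L a) - exp (c - L b)"
proof -
  \<comment> \<open>The normalization \<open>c = L a\<close> keeps the exponentials at most 1 to the
    right of \<open>a\<close>, so that the increments are bounded by the square with constant 1; a
    general \<open>c\<close> only contributes a factor.\<close>
  define F where "F y = exp (L a - L y) + (LINT u:{a..y}|lborel. l u * exp (L a - L u))" for y
  have "F a = F b"
  proof (rule eq_if_increments_quadratic[OF ab, of L])
    show "mono_on {a..b} L" by (simp add: mono_on_def L_mono)
    fix x y assume xy: "a \<le> x" "x \<le> y" "y \<le> b"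
    let ?I = "LINT u:{x..y}|lborel. l u * exp (L a - L u)"
    have "(LINT u:{a..y}|lborel. l u * exp (L a - L u))
        = (LINT u:{a..x} \<union> {x..y}|lborel. l u * exp (L a - L u))"
      using xy by (simp add: ivl_disj_un_two_touch)
    also have "\<dots> = (LINT u:{a..x}|lborel. l u * exp (L a - L u)) + ?I"
      by (rule set_integral_Un_AE)
        (use AE_lborel_singleton[of x] in \<open>auto simp: l_exp_integrable elim!: eventually_mono\<close>)
    finally have F: "F y - F x = ?I - (exp (L a - L x) - exp (L a - L y))"
      by (simp add: F_def)
    let ?\<Delta> = "L y - L x" and ?p = "exp (L a - L x)" and ?q = "exp (L a - L y)"
    have \<Delta>: "0 \<le> ?\<Delta>" using L_mono xy by simp
    have "?I \<le> (LINT u:{x..y}|lborel. ?p * l u)"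
      by (rule set_integral_mono[OF l_exp_integrable]) (auto simp: mult.commute L_mono intro!: mult_left_mono)
    then have I1: "?I \<le> ?p * ?\<Delta>" using L_diff[OF xy(2)] by simp
    have "(LINT u:{x..y}|lborel. ?q * l u) \<le> ?I"
      by (rule set_integral_mono[OF _ l_exp_integrable]) (auto simp: mult.commute L_mono intro!: mult_left_mono)
    then have I2: "?q * ?\<Delta> \<le> ?I" using L_diff[OF xy(2)] by simp
    have pq: "?q = ?p * exp (- ?\<Delta>)" by (simp flip: exp_add)
    have E1: "?p - ?q \<le> ?p * ?\<Delta>"
      using mult_left_mono[OF exp_ge_add_one_self[of "- ?\<Delta>"], of ?p] by (simp add: pq algebra_simps)
    have pq': "?p = ?q * exp ?\<Delta>" by (simp flip: exp_add)
    have E2: "?q * ?\<Delta> \<le> ?p - ?q"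
      using mult_left_mono[OF exp_ge_add_one_self[of ?\<Delta>], of ?q] by (simp add: pq' algebra_simps)
    \<comment> \<open>Both \<open>?I\<close> and \<open>?p - ?q\<close> lie between
      \<open>?q * ?\<Delta>\<close> and \<open>?p * ?\<Delta>\<close>, so they differ by at most the
      length of that interval.\<close>
    have "\<bar>F y - F x\<bar> \<le> (?p - ?q) * ?\<Delta>"
      unfolding F using I1 I2 E1 E2 by (simp add: algebra_simps abs_le_iff)
    also have "\<dots> \<le> (?p * ?\<Delta>) * ?\<Delta>" by (rule mult_right_mono[OF E1 \<Delta>])
    also have "\<dots> \<le> (1 * ?\<Delta>) * ?\<Delta>"
      using L_mono[OF xy(1)] \<Delta> by (intro mult_right_mono) auto
    finally show "\<bar>F y - F x\<bar> \<le> (L y - L x)\<^sup>2" by (simp add: power2_eq_square)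
  qed (rule L_continuous)
  moreover have "(LINT u:{a..a}|lborel. l u * exp (L a - L u)) = 0"
    by (simp add: set_lebesgue_integral_def) (rule integral_eq_zero_AE, use AE_lborel_singleton[of a] in \<open>auto elim!: eventually_mono\<close>)
  ultimately have *: "(LINT u:{a..b}|lborel. l u * exp (L a - L u)) = 1 - exp (L a - L b)"
    by (simp add: F_def)
  have exp: "l u * exp (c - L u) = exp (c - L a) * (l u * exp (L a - L u))" for u
    by (simp flip: exp_add)
  have "(LINT u:{a..b}|lborel. l u * exp (c - L u)) = exp (c - L a) * (1 - exp (L a - L b))"
    unfolding *[symmetric] exp by simp
  also have "\<dots> = exp (c - L a) - exp (c - L b)"
    by (simp add: right_diff_distrib flip: exp_add)
  finally show ?thesis .
qed

end

context intensity
begin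

text \<open>The survival function is prescribed up to T only, so the law is restricted to times
  between t and T. The restrictions are finite and hence determined by their distribution functions,
  where \<open>integral_l_exp\<close> writes a difference of survival probabilities as an integral
  of the density.\<close>

lemma first_time_law:
  assumes "prob_space M" and tT: "t \<le> T" and \<tau>[measurable]: "\<tau>\<^sub>1 \<in> borel_measurable M"
    and D1: "\<And>s. s \<in> {t..T} \<Longrightarrow> measure M {\<omega>\<in>space M. s < \<tau>\<^sub>1 \<omega>} = exp (L t - L s)"
  shows "density (distr M borel \<tau>\<^sub>1) (indicator {t<..T})
       = density lborel (\<lambda>x. ennreal (indicator {t<..T} x * (l x * exp (L t - L x))))" (is "?\<mu> = ?\<nu>")
proof -
  interpret prob_space M by fact
  have \<mu>: "emeasure ?\<mu> A = emeasure M {\<omega>\<in>space M. \<tau>\<^sub>1 \<omega> \<in> A \<inter> {t<..T}}" if [measurable]: "A \<in> sets borel" for A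
  proof -
    have "emeasure ?\<mu> A = emeasure (distr M borel \<tau>\<^sub>1) ({t<..T} \<inter> A)"
      by (subst emeasure_density) (auto simp flip: indicator_inter_arith)
    also have "\<dots> = emeasure M {\<omega>\<in>space M. \<tau>\<^sub>1 \<omega> \<in> A \<inter> {t<..T}}"
      by (subst emeasure_distr) (auto intro!: arg_cong2[where f=emeasure])
    finally show ?thesis .
  qed
  have eq: "emeasure ?\<mu> {..x} = emeasure ?\<nu> {..x}" for x
  proof (cases "x \<le> t")
    case True
    have "{\<omega>\<in>space M. \<tau>\<^sub>1 \<omega> \<in> {..x} \<inter> {t<..T}} = {}" using True by auto
    then have "emeasure ?\<mu> {..x} = 0" by (simp only: \<mu> atMost_borel emeasure_empty)
    moreover have "emeasure ?\<nu> {..x} = 0"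
      using True by (subst emeasure_density) (auto simp: nn_integral_0_iff_AE split: split_indicator)
    ultimately show ?thesis by simp
  next
    case False
    define m where "m = min x T"
    have m: "t \<le> m" "m \<le> T" using False tT by (auto simp: m_def)
    have "{\<omega>\<in>space M. \<tau>\<^sub>1 \<omega> \<in> {..x} \<inter> {t<..T}} = {\<omega>\<in>space M. t < \<tau>\<^sub>1 \<omega>} - {\<omega>\<in>space M. m < \<tau>\<^sub>1 \<omega>}"
      by (auto simp: m_def)
    then have "emeasure ?\<mu> {..x} = ennreal (measure M ({\<omega>\<in>space M. t < \<tau>\<^sub>1 \<omega>} - {\<omega>\<in>space M. m < \<tau>\<^sub>1 \<omega>}))"
      by (subst \<mu>) (auto simp: emeasure_eq_measure)
    also have "measure M ({\<omega>\<in>space M. t < \<tau>\<^sub>1 \<omega>} - {\<omega>\<in>space M. m < \<tau>\<^sub>1 \<omega>}) = exp (L t - L t) - exp (L t - L m)"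
      using m by (subst finite_measure_Diff) (auto simp: D1)
    also have "\<dots> = (LINT u:{t..m}|lborel. l u * exp (L t - L u))"
      by (rule integral_l_exp[symmetric]) (use m in auto)
    also have "ennreal \<dots> = (\<integral>\<^sup>+u. ennreal (indicator {t..m} u * (l u * exp (L t - L u))) \<partial>lborel)"
      unfolding set_lebesgue_integral_def
      using l_exp_integrable[of t m "L t"]
      by (subst nn_integral_eq_integral) (auto simp: set_integrable_def)
    also have "\<dots> = emeasure ?\<nu> {..x}"
      by (subst emeasure_density, simp, simp, rule nn_integral_cong_AE)
        (use AE_lborel_singleton[of t] in \<open>auto simp: m_def elim!: eventually_mono split: split_indicator\<close>)
    finally show ?thesis .
  qed
  have fin: "emeasure ?\<nu> (space ?\<nu>) \<noteq> \<infinity>"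
  proof -
    have "emeasure ?\<nu> (space ?\<nu>) = emeasure ?\<nu> {..T}"
      by (simp add: emeasure_density) (auto intro!: nn_integral_cong split: split_indicator)
    also have "\<dots> = emeasure M {\<omega>\<in>space M. \<tau>\<^sub>1 \<omega> \<in> {..T} \<inter> {t<..T}}"
      by (subst eq[symmetric], rule \<mu>) simp
    finally show ?thesis by simp
  qed
  interpret m: finite_measure ?\<mu> by (rule finite_measureI) (use \<mu>[of UNIV] in simp)
  interpret n: finite_measure ?\<nu> by (rule finite_measureI) (rule fin)
  show ?thesis
  proof (rule cdf_unique')
    show "finite_borel_measure ?\<mu>" by standard simp
    show "finite_borel_measure ?\<nu>" by standard simp
    show "cdf ?\<mu> = cdf ?\<nu>" by (rule ext) (simp add: cdf_def measure_def eq)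
  qed
qed

text \<open>Rectangles \<open>A \<times> {..s}\<close> are the convenient generator here: \<open>\<tau>\<^sub>1 < \<tau>\<^sub>2 \<le> s\<close> forces \<open>\<tau>\<^sub>1 < s\<close>, so the
  conditional law of \<open>\<tau>\<^sub>2\<close> is only needed at times after \<open>\<tau>\<^sub>1\<close>.\<close>

lemma interaction_times_law:
  assumes "prob_space M" and tT: "t \<le> T"
    and \<tau>[measurable]: "\<tau>\<^sub>1 \<in> borel_measurable M" "\<tau>\<^sub>2 \<in> borel_measurable M"
    and lt: "AE \<omega> in M. \<tau>\<^sub>1 \<omega> < \<tau>\<^sub>2 \<omega>"
    and D1: "\<And>s. s \<in> {t..T} \<Longrightarrow> measure M {\<omega>\<in>space M. s < \<tau>\<^sub>1 \<omega>} = exp (L t - L s)"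
    and D2: "\<And>s. s \<in> {t..T} \<Longrightarrow> AE \<omega> in M. t < \<tau>\<^sub>1 \<omega> \<and> \<tau>\<^sub>1 \<omega> < s \<longrightarrow>
        real_cond_exp M (vimage_algebra (space M) \<tau>\<^sub>1 borel)
          (indicator {\<omega>\<in>space M. s < \<tau>\<^sub>2 \<omega>}) \<omega> = exp (L (\<tau>\<^sub>1 \<omega>) - L s)"
  defines "D \<equiv> {(x, y). t < x \<and> x < y \<and> y \<le> T}"
  shows "density (distr M (borel \<Otimes>\<^sub>M borel) (\<lambda>\<omega>. (\<tau>\<^sub>1 \<omega>, \<tau>\<^sub>2 \<omega>))) (indicator D)
       = density (lborel \<Otimes>\<^sub>M lborel) (\<lambda>(x, y). ennreal (indicator D (x, y) * (l x * l y * exp (L t - L y))))"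
    (is "?\<mu> = ?\<nu>")
proof -
  interpret prob_space M by fact
  let ?G = "vimage_algebra (space M) \<tau>\<^sub>1 borel"
  have sub: "subalgebra M ?G"
    using measurable_sets[OF \<tau>(1)] by (auto simp: subalgebra_def sets_vimage_algebra2)
  interpret G: finite_measure_subalgebra M ?G by standard (rule sub)
  have [measurable]: "\<tau>\<^sub>1 \<in> measurable ?G borel"
    by (rule measurable_vimage_algebra1) simp
  have Deq: "D = {p \<in> space (borel \<Otimes>\<^sub>M borel). t < fst p \<and> fst p < snd p \<and> snd p \<le> T}"
    by (auto simp: D_def space_pair_measure)
  have Dm[measurable]: "D \<in> sets (borel \<Otimes>\<^sub>M borel)"
    unfolding Deq by measurable
  have \<mu>: "emeasure ?\<mu> A = emeasure M {\<omega>\<in>space M. (\<tau>\<^sub>1 \<omega>, \<tau>\<^sub>2 \<omega>) \<in> A \<inter> D}"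
    if [measurable]: "A \<in> sets (borel \<Otimes>\<^sub>M borel)" for A
  proof -
    have "emeasure ?\<mu> A = emeasure (distr M (borel \<Otimes>\<^sub>M borel) (\<lambda>\<omega>. (\<tau>\<^sub>1 \<omega>, \<tau>\<^sub>2 \<omega>))) (D \<inter> A)"
      by (subst emeasure_density) (auto simp flip: indicator_inter_arith)
    also have "\<dots> = emeasure M {\<omega>\<in>space M. (\<tau>\<^sub>1 \<omega>, \<tau>\<^sub>2 \<omega>) \<in> A \<inter> D}"
      by (subst emeasure_distr) (auto intro!: arg_cong2[where f=emeasure])
    finally show ?thesis .
  qed
  have rect: "emeasure ?\<mu> (A \<times> {..s}) = emeasure ?\<nu> (A \<times> {..s})" if A[measurable]: "A \<in> sets borel" for A s
  proof (cases "s \<le> t")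
    case True
    have "{\<omega>\<in>space M. (\<tau>\<^sub>1 \<omega>, \<tau>\<^sub>2 \<omega>) \<in> (A \<times> {..s}) \<inter> D} = {}" using True by (auto simp: D_def)
    then have "emeasure ?\<mu> (A \<times> {..s}) = 0" using \<mu>[of "A \<times> {..s}"] by (simp only: pair_measureI A atMost_borel emeasure_empty)
    moreover have "emeasure ?\<nu> (A \<times> {..s}) = 0"
      using True by (subst emeasure_density) (auto simp: nn_integral_0_iff_AE D_def split: split_indicator)
    ultimately show ?thesis by simp
  next
    case False
    define m where "m = min s T"
    have m: "t \<le> m" "m \<le> T" using False tT by (auto simp: m_def)
    \<comment> \<open>With \<open>m\<close> the smaller of \<open>s\<close> and \<open>T\<close>,
      the bounds on both times in the rectangle and in \<open>D\<close> reduce to a first time in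
      \<open>A'\<close> and a second time at most \<open>m\<close>.\<close>
    define A' where "A' = A \<inter> {t<..<m}"
    have A'[measurable]: "A' \<in> sets borel" by (simp add: A'_def)
    let ?B = "{\<omega>\<in>space M. \<tau>\<^sub>1 \<omega> \<in> A' \<and> m < \<tau>\<^sub>2 \<omega>}"
    \<comment> \<open>On \<open>A'\<close> this is the conditional probability that the second event
      happens by time \<open>m\<close>, given that the first happens at \<open>x\<close>.\<close>
    define h where "h x = indicator A' x * (1 - exp (L x - L m))" for x
    have h[measurable]: "h \<in> borel_measurable borel" by (simp add: h_def[abs_def])
    have h0: "0 \<le> h x" and h1: "h x \<le> 1" for x
      by (auto simp: h_def A'_def L_mono split: split_indicator)
    have "emeasure ?\<mu> (A \<times> {..s}) = emeasure M ({\<omega>\<in>space M. \<tau>\<^sub>1 \<omega> \<in> A'} - ?B)"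
      by (subst \<mu>, simp, rule emeasure_eq_AE)
        (use lt in \<open>auto simp: A'_def m_def D_def elim!: eventually_mono\<close>)
    also have "\<dots> = ennreal (measure M {\<omega>\<in>space M. \<tau>\<^sub>1 \<omega> \<in> A'} - measure M ?B)"
      by (subst emeasure_eq_measure, subst finite_measure_Diff) auto
    also have "measure M ?B = (LINT \<omega>|M. indicator A' (\<tau>\<^sub>1 \<omega>) * indicator {\<omega>\<in>space M. m < \<tau>\<^sub>2 \<omega>} \<omega>)"
    proof -
      have "measure M ?B = (LINT \<omega>|M. indicator ?B \<omega>)" by simp
      also have "\<dots> = (LINT \<omega>|M. indicator A' (\<tau>\<^sub>1 \<omega>) * indicator {\<omega>\<in>space M. m < \<tau>\<^sub>2 \<omega>} \<omega>)"
        by (intro Bochner_Integration.integral_cong) (auto split: split_indicator)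
      finally show ?thesis .
    qed
    also have "\<dots> = (LINT \<omega>|M. indicator A' (\<tau>\<^sub>1 \<omega>) * real_cond_exp M ?G (indicator {\<omega>\<in>space M. m < \<tau>\<^sub>2 \<omega>}) \<omega>)"
      by (rule G.real_cond_exp_intg(2)[symmetric])
        (auto intro!: integrable_const_bound[of _ 1] simp: abs_mult split: split_indicator)
    also have "\<dots> = (LINT \<omega>|M. indicator A' (\<tau>\<^sub>1 \<omega>) * exp (L (\<tau>\<^sub>1 \<omega>) - L m))"
      using D2[of m] m
      by (intro integral_cong_AE) (auto simp: A'_def elim!: eventually_mono split: split_indicator)
    also have "measure M {\<omega>\<in>space M. \<tau>\<^sub>1 \<omega> \<in> A'} = (LINT \<omega>|M. indicator A' (\<tau>\<^sub>1 \<omega>))"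
    proof -
      have "measure M {\<omega>\<in>space M. \<tau>\<^sub>1 \<omega> \<in> A'} = (LINT \<omega>|M. indicator {\<omega>\<in>space M. \<tau>\<^sub>1 \<omega> \<in> A'} \<omega>)" by simp
      also have "\<dots> = (LINT \<omega>|M. indicator A' (\<tau>\<^sub>1 \<omega>))"
        by (intro Bochner_Integration.integral_cong) (auto split: split_indicator)
      finally show ?thesis .
    qed
    also have "(LINT \<omega>|M. indicator A' (\<tau>\<^sub>1 \<omega>)) - (LINT \<omega>|M. indicator A' (\<tau>\<^sub>1 \<omega>) * exp (L (\<tau>\<^sub>1 \<omega>) - L m))
       = (LINT \<omega>|M. h (\<tau>\<^sub>1 \<omega>))"
      unfolding h_def right_diff_distrib mult_1_right
      by (rule Bochner_Integration.integral_diff[symmetric])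
        (auto intro!: integrable_const_bound[of _ 1] simp: A'_def L_mono abs_mult split: split_indicator)
    also have "ennreal \<dots> = (\<integral>\<^sup>+\<omega>. h (\<tau>\<^sub>1 \<omega>) \<partial>M)"
      by (rule nn_integral_eq_integral[symmetric])
       (auto intro!: integrable_const_bound[of _ 1] simp: h0 h1)
    also have "\<dots> = (\<integral>\<^sup>+x. h x \<partial>density (distr M borel \<tau>\<^sub>1) (indicator {t<..T}))"
      by (subst nn_integral_density, simp, simp, subst nn_integral_distr)
        (use m in \<open>auto intro!: nn_integral_cong simp: h_def A'_def split: split_indicator\<close>)
    also have "\<dots> = (\<integral>\<^sup>+x. h x \<partial>density lborel (\<lambda>x. ennreal (indicator {t<..T} x * (l x * exp (L t - L x)))))"
      by (subst first_time_law[OF \<open>prob_space M\<close> tT \<tau>(1) D1]) auto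
    also have "\<dots> = (\<integral>\<^sup>+x. ennreal (indicator A' x * l x) * ennreal (exp (L t - L x) - exp (L t - L m)) \<partial>lborel)"
      using m by (subst nn_integral_density)
        (auto intro!: nn_integral_cong simp: h_def A'_def L_mono algebra_simps simp flip: ennreal_mult' exp_add split: split_indicator)
    \<comment> \<open>The difference of exponentials is itself an integral of the density over the
      second time, from \<open>x\<close> to \<open>m\<close>.\<close>
    also have "\<dots> = (\<integral>\<^sup>+x. ennreal (indicator A' x * l x) * (\<integral>\<^sup>+y. ennreal (indicator {x..m} y * (l y * exp (L t - L y))) \<partial>lborel) \<partial>lborel)"
    proof (intro nn_integral_cong)
      fix x
      show "ennreal (indicator A' x * l x) * ennreal (exp (L t - L x) - exp (L t - L m))
         = ennreal (indicator A' x * l x) * (\<integral>\<^sup>+y. ennreal (indicator {x..m} y * (l y * exp (L t - L y))) \<partial>lborel)"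
      proof (cases "x \<in> A'")
        case True
        then have "x \<le> m" by (auto simp: A'_def)
        from integral_l_exp[OF this, of "L t"] l_exp_integrable[of x m "L t"]
        show ?thesis
          by (subst nn_integral_eq_integral) (auto simp: set_integrable_def set_lebesgue_integral_def)
      qed simp
    qed
    also have "\<dots> = (\<integral>\<^sup>+x. \<integral>\<^sup>+y. ennreal (indicator D (x, y) * (l x * l y * exp (L t - L y))) * indicator (A \<times> {..s}) (x, y) \<partial>lborel \<partial>lborel)"
    proof (intro nn_integral_cong)
      fix x
      have "(\<integral>\<^sup>+y. ennreal (indicator D (x, y) * (l x * l y * exp (L t - L y))) * indicator (A \<times> {..s}) (x, y) \<partial>lborel)
        = (\<integral>\<^sup>+y. ennreal (indicator A' x * l x) * ennreal (indicator {x..m} y * (l y * exp (L t - L y))) \<partial>lborel)"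
        by (rule nn_integral_cong_AE, rule AE_mp[OF AE_lborel_singleton[of x]], rule AE_I2)
          (auto simp: A'_def D_def m_def mult.assoc simp flip: ennreal_mult' split: split_indicator)
      also have "\<dots> = ennreal (indicator A' x * l x) * (\<integral>\<^sup>+y. ennreal (indicator {x..m} y * (l y * exp (L t - L y))) \<partial>lborel)"
        by (rule nn_integral_cmult) simp
      finally show "ennreal (indicator A' x * l x) * (\<integral>\<^sup>+y. ennreal (indicator {x..m} y * (l y * exp (L t - L y))) \<partial>lborel)
         = (\<integral>\<^sup>+y. ennreal (indicator D (x, y) * (l x * l y * exp (L t - L y))) * indicator (A \<times> {..s}) (x, y) \<partial>lborel)" by simp
    qed
    also have "\<dots> = emeasure ?\<nu> (A \<times> {..s})"
      by (subst emeasure_density, simp, simp, subst lborel.nn_integral_fst[symmetric])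
         (auto simp: case_prod_beta')
    finally show ?thesis .
  qed
  have fin\<mu>: "emeasure ?\<mu> X \<noteq> \<infinity>" if "X \<in> sets (borel \<Otimes>\<^sub>M borel)" for X
    by (simp add: \<mu>[OF that])
  have rect': "emeasure ?\<mu> (A \<times> B) = emeasure ?\<nu> (A \<times> B)" if A[measurable]: "A \<in> sets borel" and B: "B \<in> sets borel" for A B
  proof -
    \<comment> \<open>From half-lines to Borel sets in the second coordinate: for fixed
      \<open>A\<close>, both restricted measures are projected to the line, where agreement on
      half-lines suffices.\<close>
    let ?m = "distr (density ?\<mu> (indicator (A \<times> UNIV))) borel snd"
    let ?n = "distr (density ?\<nu> (indicator (A \<times> UNIV))) borel snd"
    have AU[measurable]: "A \<times> UNIV \<in> sets (borel \<Otimes>\<^sub>M borel)" "A \<times> UNIV \<in> sets (lborel \<Otimes>\<^sub>M lborel)"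
      using A by (auto intro!: pair_measureI)
    have m: "emeasure ?m C = emeasure ?\<mu> (A \<times> C)" if [measurable]: "C \<in> sets borel" for C
    proof -
      have "emeasure ?m C = emeasure (density ?\<mu> (indicator (A \<times> UNIV))) (UNIV \<times> C)"
        by (subst emeasure_distr) (auto intro!: arg_cong2[where f=emeasure] simp: space_pair_measure)
      also have "\<dots> = emeasure ?\<mu> ((A \<times> UNIV) \<inter> (UNIV \<times> C))"
        using that by (subst emeasure_density) (auto simp flip: indicator_inter_arith)
      also have "(A \<times> UNIV) \<inter> (UNIV \<times> C) = A \<times> C" by auto
      finally show ?thesis .
    qed
    have n: "emeasure ?n C = emeasure ?\<nu> (A \<times> C)" if [measurable]: "C \<in> sets borel" for C
    proof -
      have "emeasure ?n C = emeasure (density ?\<nu> (indicator (A \<times> UNIV))) (UNIV \<times> C)"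
        by (subst emeasure_distr) (auto intro!: arg_cong2[where f=emeasure] simp: space_pair_measure)
      also have "\<dots> = emeasure ?\<nu> ((A \<times> UNIV) \<inter> (UNIV \<times> C))"
        using that by (subst emeasure_density) (auto simp flip: indicator_inter_arith)
      also have "(A \<times> UNIV) \<inter> (UNIV \<times> C) = A \<times> C" by auto
      finally show ?thesis .
    qed
    \<comment> \<open>\<open>D\<close> forces the second coordinate to be at most \<open>T\<close>,
      so the total mass is already that of a half-line rectangle, which is known to be
      finite.\<close>
    have "emeasure ?\<nu> (A \<times> UNIV) = emeasure ?\<nu> (A \<times> {..T})"
      by (subst (1 2) emeasure_density) (auto intro!: nn_integral_cong simp: D_def split: split_indicator)
    then have fin\<nu>: "emeasure ?\<nu> (A \<times> UNIV) \<noteq> \<infinity>" 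
      using fin\<mu>[of "A \<times> {..T}"] rect[OF A, of T] by (simp only: pair_measureI A atMost_borel) simp
    interpret m: finite_measure ?m
      by (rule finite_measureI) (use m[of UNIV] fin\<mu>[of "A \<times> UNIV"] in simp)
    interpret n: finite_measure ?n
      by (rule finite_measureI) (use n[of UNIV] fin\<nu> in simp)
    have "?m = ?n"
    proof (rule cdf_unique')
      show "finite_borel_measure ?m" by standard simp
      show "finite_borel_measure ?n" by standard simp
      show "cdf ?m = cdf ?n" by (rule ext) (simp add: cdf_def measure_def m n rect)
    qed
    then show ?thesis using m[OF B] n[OF B] by simp
  qed
  show ?thesis
  proof (rule measure_eqI_generator_eq[where E="{a \<times> b | a b. a \<in> sets borel \<and> b \<in> sets borel}" and \<Omega>=UNIV and A="\<lambda>_. UNIV"])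
    show "Int_stable {a \<times> b | a b. a \<in> sets (borel::real measure) \<and> b \<in> sets (borel::real measure)}"
      by (rule Int_stable_pair_measure_generator)
    show "sets ?\<mu> = sigma_sets UNIV {a \<times> b | a b. a \<in> sets borel \<and> b \<in> sets borel}"
      by (simp add: sets_pair_measure)
    show "sets ?\<nu> = sigma_sets UNIV {a \<times> b | a b. a \<in> sets borel \<and> b \<in> sets borel}"
      by (simp add: sets_pair_measure)
    show "emeasure ?\<mu> UNIV \<noteq> \<infinity>" using fin\<mu>[of UNIV] by (metis sets.top space_pair_measure space_borel UNIV_Times_UNIV)
  qed (use rect' in \<open>auto intro!: exI[of _ UNIV]\<close>)
qed

end

subsection \<open>Independence of the interaction times and the filtration\<close>

lemma space_natural_filtration[simp]: "space (natural_filtration M W s) = space M"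
  by (auto simp: natural_filtration_def space_measure_of_conv)

lemma space_augmented_filtration[simp]: "space (augmented_filtration M W s) = space M"
  by (auto simp: augmented_filtration_def space_measure_of_conv)

lemma sets_natural_filtration:
  "sets (natural_filtration M W s) = sigma_sets (space M) (\<Union>u\<in>{0..s}. {W u -` B \<inter> space M | B. B \<in> sets borel})"
  unfolding natural_filtration_def by (rule sets_measure_of) auto

lemma sets_augmented_filtration:
  "sets (augmented_filtration M W s) = sigma_sets (space M) (sets (natural_filtration M W s) \<union> null_sets M)"
  unfolding augmented_filtration_def
  by (rule sets_measure_of) (use sets.sets_into_space[of _ "natural_filtration M W s"] sets.sets_into_space[of _ M] in auto)

lemma sets_natural_filtration_subset:
  assumes "\<And>u. u \<in> {0..s} \<Longrightarrow> W u \<in> borel_measurable M"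
  shows "sets (natural_filtration M W s) \<subseteq> sets M"
  unfolding sets_natural_filtration
  by (rule sets.sigma_sets_subset) (use assms in \<open>auto intro: measurable_sets\<close>)

lemma subalgebra_augmented_filtration:
  assumes "\<And>u. u \<in> {0..s} \<Longrightarrow> W u \<in> borel_measurable M"
  shows "subalgebra M (augmented_filtration M W s)"
proof -
  have "sets (augmented_filtration M W s) \<subseteq> sets M"
    unfolding sets_augmented_filtration
    by (rule sets.sigma_sets_subset) (use sets_natural_filtration_subset[OF assms] in auto)
  then show ?thesis by (simp add: subalgebra_def)
qed

lemma subalgebra_augmented_filtration_mono:
  assumes "s \<le> u"
  shows "subalgebra (augmented_filtration M W u) (augmented_filtration M W s)"
proof -
  have "sets (natural_filtration M W s) \<subseteq> sets (natural_filtration M W u)"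
    unfolding sets_natural_filtration
    by (intro sigma_sets_mono' UN_mono) (use assms in auto)
  then have "sets (augmented_filtration M W s) \<subseteq> sets (augmented_filtration M W u)"
    unfolding sets_augmented_filtration by (intro sigma_sets_mono') auto
  then show ?thesis by (simp add: subalgebra_def)
qed

text \<open>Null sets are independent of every event, and together with the natural sigma-algebra
  they form an intersection-stable generator of the augmented one.\<close>

lemma (in prob_space) indep_set_augmented_filtration:
  assumes ind: "indep_set (sets N) (sets (natural_filtration M W s))"
    and N: "space N = space M"
  shows "indep_set (sets N) (sets (augmented_filtration M W s))"
proof -
  let ?F = "natural_filtration M W s"
  have ev: "sets N \<subseteq> events" "sets ?F \<subseteq> events"
    using indep_setD_ev1[OF ind] indep_setD_ev2[OF ind] by auto
  have "indep_set (sets N) (sets ?F \<union> null_sets M)"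
  proof (rule indep_setI)
    fix a b assume a: "a \<in> sets N" and b: "b \<in> sets ?F \<union> null_sets M"
    show "prob (a \<inter> b) = prob a * prob b"
    proof (cases "b \<in> null_sets M")
      case True
      then have "a \<inter> b \<in> null_sets M" using a ev by (auto intro: null_set_Int1)
      then show ?thesis using True by (simp add: measure_eq_0_null_sets)
    next
      case False
      then show ?thesis using indep_setD[OF ind a] b by simp
    qed
  qed (use ev in auto)
  then have "indep_set (sigma_sets (space M) (sets N)) (sigma_sets (space M) (sets ?F \<union> null_sets M))"
  proof (rule indep_set_sigma_sets)
    show "Int_stable (sets N)" by (auto simp: Int_stable_def)
    show "Int_stable (sets ?F \<union> null_sets M)"
      using ev(2) by (auto simp: Int_stable_def intro: null_set_Int1 null_set_Int2)
  qed
  moreover have "sigma_sets (space M) (sets N) = sets N"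
    using sets.sigma_sets_eq[of N] N by simp
  ultimately show ?thesis by (simp add: sets_augmented_filtration)
qed

text \<open>The identity map into \<open>F\<close> serves as the second random variable.
  Independence then says that \<omega>, as far as \<open>F\<close> can see it, may be decoupled from
  \<open>X\<close>, for integrands that depend on the whole of \<omega>.\<close>

lemma (in prob_space) distr_Pair_indep_subalgebra:
  assumes ind: "indep_set (sets (vimage_algebra (space M) X S)) (sets F)"
    and X: "X \<in> measurable M S" and F: "subalgebra M F"
  shows "distr M S X \<Otimes>\<^sub>M distr M F (\<lambda>\<omega>. \<omega>) = distr M (S \<Otimes>\<^sub>M F) (\<lambda>\<omega>. (X \<omega>, \<omega>))"
proof (rule pair_measure_eqI)
  have id: "(\<lambda>\<omega>. \<omega>) \<in> measurable M F"
    using F by (auto simp: subalgebra_def measurable_def)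
  have P: "(\<lambda>\<omega>. (X \<omega>, \<omega>)) \<in> measurable M (S \<Otimes>\<^sub>M F)"
    using X id by measurable
  show "sigma_finite_measure (distr M S X)" "sigma_finite_measure (distr M F (\<lambda>\<omega>. \<omega>))"
    using X id by (simp_all add: prob_space_distr prob_space_imp_sigma_finite)
  fix A B assume "A \<in> sets (distr M S X)" "B \<in> sets (distr M F (\<lambda>\<omega>. \<omega>))"
  then have A: "A \<in> sets S" and B: "B \<in> sets F" by auto
  have BM: "B \<in> events" "B \<subseteq> space M" using B F sets.sets_into_space[of B M] by (auto simp: subalgebra_def)
  have XA: "X -` A \<inter> space M \<in> sets (vimage_algebra (space M) X S)"
    using A by (rule in_vimage_algebra)
  have "emeasure (distr M S X) A * emeasure (distr M F (\<lambda>\<omega>. \<omega>)) B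
      = emeasure M (X -` A \<inter> space M) * emeasure M B"
    using A B X id BM by (simp add: emeasure_distr Int_absorb2)
  also have "\<dots> = emeasure M ((X -` A \<inter> space M) \<inter> B)"
    using indep_setD[OF ind XA B] by (simp add: emeasure_eq_measure ennreal_mult')
  also have "\<dots> = emeasure (distr M (S \<Otimes>\<^sub>M F) (\<lambda>\<omega>. (X \<omega>, \<omega>))) (A \<times> B)"
    using A B P BM by (subst emeasure_distr) (auto intro!: arg_cong2[where f=emeasure])
  finally show "emeasure (distr M S X) A * emeasure (distr M F (\<lambda>\<omega>. \<omega>)) B
     = emeasure (distr M (S \<Otimes>\<^sub>M F) (\<lambda>\<omega>. (X \<omega>, \<omega>))) (A \<times> B)" .
qed simp

lemma distr_pair_measure_assoc:
  assumes "sigma_finite_measure A" "sigma_finite_measure B" "sigma_finite_measure C"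
  shows "distr ((A \<Otimes>\<^sub>M B) \<Otimes>\<^sub>M C) (A \<Otimes>\<^sub>M (B \<Otimes>\<^sub>M C)) (\<lambda>((x, y), z). (x, (y, z))) = A \<Otimes>\<^sub>M (B \<Otimes>\<^sub>M C)"
proof (rule measure_eqI)
  interpret A: sigma_finite_measure A by fact
  interpret B: sigma_finite_measure B by fact
  interpret C: sigma_finite_measure C by fact
  interpret BC: pair_sigma_finite B C ..
  interpret AB: pair_sigma_finite A B ..
  fix X assume "X \<in> sets (distr ((A \<Otimes>\<^sub>M B) \<Otimes>\<^sub>M C) (A \<Otimes>\<^sub>M (B \<Otimes>\<^sub>M C)) (\<lambda>((x, y), z). (x, (y, z))))"
  then have X[measurable]: "X \<in> sets (A \<Otimes>\<^sub>M (B \<Otimes>\<^sub>M C))" by simp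
  have "emeasure (distr ((A \<Otimes>\<^sub>M B) \<Otimes>\<^sub>M C) (A \<Otimes>\<^sub>M (B \<Otimes>\<^sub>M C)) (\<lambda>((x, y), z). (x, (y, z)))) X
     = (\<integral>\<^sup>+p. indicator X p \<partial>distr ((A \<Otimes>\<^sub>M B) \<Otimes>\<^sub>M C) (A \<Otimes>\<^sub>M (B \<Otimes>\<^sub>M C)) (\<lambda>((x, y), z). (x, (y, z))))"
    by simp
  also have "\<dots> = (\<integral>\<^sup>+p. indicator X (fst (fst p), (snd (fst p), snd p)) \<partial>((A \<Otimes>\<^sub>M B) \<Otimes>\<^sub>M C))"
    by (subst nn_integral_distr) (auto simp: case_prod_beta')
  also have "\<dots> = (\<integral>\<^sup>+r. \<integral>\<^sup>+z. indicator X (fst r, (snd r, z)) \<partial>C \<partial>(A \<Otimes>\<^sub>M B))"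
    by (subst C.nn_integral_fst[symmetric]) auto
  also have "\<dots> = (\<integral>\<^sup>+x. \<integral>\<^sup>+y. \<integral>\<^sup>+z. indicator X (x, (y, z)) \<partial>C \<partial>B \<partial>A)"
    by (subst B.nn_integral_fst[symmetric]) auto
  also have "\<dots> = (\<integral>\<^sup>+x. \<integral>\<^sup>+r. indicator X (x, r) \<partial>(B \<Otimes>\<^sub>M C) \<partial>A)"
  proof (rule nn_integral_cong)
    fix x assume "x \<in> space A"
    then have "(\<lambda>r. indicator X (x, r) :: ennreal) \<in> borel_measurable (B \<Otimes>\<^sub>M C)" by measurable
    from C.nn_integral_fst[OF this]
    show "(\<integral>\<^sup>+y. \<integral>\<^sup>+z. indicator X (x, (y, z)) \<partial>C \<partial>B) = (\<integral>\<^sup>+r. indicator X (x, r) \<partial>(B \<Otimes>\<^sub>M C))"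
      by simp
  qed
  also have "\<dots> = (\<integral>\<^sup>+p. indicator X p \<partial>(A \<Otimes>\<^sub>M (B \<Otimes>\<^sub>M C)))"
    by (subst BC.nn_integral_fst[symmetric]) auto
  finally show "emeasure (distr ((A \<Otimes>\<^sub>M B) \<Otimes>\<^sub>M C) (A \<Otimes>\<^sub>M (B \<Otimes>\<^sub>M C)) (\<lambda>((x, y), z). (x, (y, z)))) X
    = emeasure (A \<Otimes>\<^sub>M (B \<Otimes>\<^sub>M C)) X" by simp
qed simp

text \<open>By Tonelli both almost-everywhere statements say that the triple integral of
  \<open>Z\<close> is 0; \<open>Z\<close> is nonnegative so that vanishing can be expressed by an
  integral.\<close>

lemma AE_pair_measure_exchange:
  assumes "sigma_finite_measure A" "sigma_finite_measure B" "sigma_finite_measure C"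
    and Z[measurable]: "(\<lambda>(x, y, z). Z x y z :: ennreal) \<in> borel_measurable (A \<Otimes>\<^sub>M (B \<Otimes>\<^sub>M C))"
    and ae: "AE x in A. AE (y, z) in B \<Otimes>\<^sub>M C. Z x y z = 0"
  shows "AE y in B. AE (x, z) in A \<Otimes>\<^sub>M C. Z x y z = 0"
proof -
  interpret A: sigma_finite_measure A by fact
  interpret B: sigma_finite_measure B by fact
  interpret C: sigma_finite_measure C by fact
  interpret BC: pair_sigma_finite B C ..
  interpret AB: pair_sigma_finite A B ..
  have m1: "(\<lambda>(y, z). Z x y z) \<in> borel_measurable (B \<Otimes>\<^sub>M C)" if "x \<in> space A" for x
    using measurable_Pair2[OF Z that] by simp
  have m3: "(\<lambda>((x, y), z). Z x y z) \<in> borel_measurable ((A \<Otimes>\<^sub>M B) \<Otimes>\<^sub>M C)"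
  proof -
    have "(\<lambda>p. (\<lambda>(x, y, z). Z x y z) (fst (fst p), snd (fst p), snd p)) \<in> borel_measurable ((A \<Otimes>\<^sub>M B) \<Otimes>\<^sub>M C)"
      by measurable
    then show ?thesis by (simp add: case_prod_beta')
  qed
  have m2: "(\<lambda>(y, x, z). Z x y z) \<in> borel_measurable (B \<Otimes>\<^sub>M (A \<Otimes>\<^sub>M C))"
  proof -
    have "(\<lambda>p. (\<lambda>(x, y, z). Z x y z) (fst (snd p), fst p, snd (snd p))) \<in> borel_measurable (B \<Otimes>\<^sub>M (A \<Otimes>\<^sub>M C))"
      by measurable
    then show ?thesis by (simp add: case_prod_beta')
  qed
  have m4: "(\<lambda>(x, z). Z x y z) \<in> borel_measurable (A \<Otimes>\<^sub>M C)" if "y \<in> space B" for y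
    using measurable_Pair2[OF m2 that] by simp
  have m5[measurable]: "(\<lambda>(x, y). \<integral>\<^sup>+z. Z x y z \<partial>C) \<in> borel_measurable (A \<Otimes>\<^sub>M B)"
    using C.borel_measurable_nn_integral_fst[OF m3] by (simp add: case_prod_beta')
  have "AE x in A. (\<integral>\<^sup>+(y, z). Z x y z \<partial>(B \<Otimes>\<^sub>M C)) = 0"
    using ae AE_space[of A]
    by eventually_elim (use nn_integral_0_iff_AE[OF m1] in \<open>simp add: case_prod_beta'\<close>)
  from nn_integral_cong_AE[OF this]
  have "0 = (\<integral>\<^sup>+x. \<integral>\<^sup>+(y, z). Z x y z \<partial>(B \<Otimes>\<^sub>M C) \<partial>A)"
    by (simp only: nn_integral_const mult_zero_left)
  also have "\<dots> = (\<integral>\<^sup>+x. \<integral>\<^sup>+y. \<integral>\<^sup>+z. Z x y z \<partial>C \<partial>B \<partial>A)"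
    using C.nn_integral_fst[OF m1] by (intro nn_integral_cong) simp
  also have "\<dots> = (\<integral>\<^sup>+y. \<integral>\<^sup>+x. \<integral>\<^sup>+z. Z x y z \<partial>C \<partial>A \<partial>B)"
    using AB.Fubini[OF m5] by simp
  also have "\<dots> = (\<integral>\<^sup>+y. \<integral>\<^sup>+(x, z). Z x y z \<partial>(A \<Otimes>\<^sub>M C) \<partial>B)"
    using C.nn_integral_fst[OF m4] by (intro nn_integral_cong) simp
  finally have "(\<integral>\<^sup>+y. \<integral>\<^sup>+(x, z). Z x y z \<partial>(A \<Otimes>\<^sub>M C) \<partial>B) = 0" by simp
  moreover interpret AC: pair_sigma_finite A C ..
  have "(\<lambda>y. \<integral>\<^sup>+(x, z). Z x y z \<partial>(A \<Otimes>\<^sub>M C)) \<in> borel_measurable B"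
    using AC.borel_measurable_nn_integral_fst[OF m2] by simp
  ultimately have "AE y in B. (\<integral>\<^sup>+(x, z). Z x y z \<partial>(A \<Otimes>\<^sub>M C)) = 0"
    by (simp add: nn_integral_0_iff_AE)
  with AE_space[of B] show ?thesis
    by eventually_elim (use nn_integral_0_iff_AE[OF m4] in \<open>simp add: case_prod_beta'\<close>)
qed

text \<open>The particle principle: dividing \<open>q\<close> by the joint density of the two times
  makes sampling at these times reproduce the Lebesgue integral. The denominator in \<open>H\<close>
  is that density on \<open>D\<close>.\<close>

lemma (in intensity) integral_over_interaction_times:
  fixes q :: "real \<Rightarrow> real \<Rightarrow> 'a \<Rightarrow> real"
  assumes M: "prob_space M" and F: "subalgebra M F"
    and \<tau>[measurable]: "\<tau>\<^sub>1 \<in> borel_measurable M" "\<tau>\<^sub>2 \<in> borel_measurable M"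
    and ind: "distr M (borel \<Otimes>\<^sub>M borel) (\<lambda>\<omega>. (\<tau>\<^sub>1 \<omega>, \<tau>\<^sub>2 \<omega>)) \<Otimes>\<^sub>M distr M F (\<lambda>\<omega>. \<omega>)
        = distr M ((borel \<Otimes>\<^sub>M borel) \<Otimes>\<^sub>M F) (\<lambda>\<omega>. ((\<tau>\<^sub>1 \<omega>, \<tau>\<^sub>2 \<omega>), \<omega>))"
    and law: "density (distr M (borel \<Otimes>\<^sub>M borel) (\<lambda>\<omega>. (\<tau>\<^sub>1 \<omega>, \<tau>\<^sub>2 \<omega>))) (indicator D)
       = density (lborel \<Otimes>\<^sub>M lborel) (\<lambda>(x, y). ennreal (indicator D (x, y) * (l x * l y * exp (c - L y))))"
    and D[measurable]: "D \<in> sets (borel \<Otimes>\<^sub>M borel)"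
    and pos: "\<And>x y. (x, y) \<in> D \<Longrightarrow> 0 < l x \<and> 0 < l y"
    and q: "(\<lambda>(x, y, \<omega>). q x y \<omega>) \<in> borel_measurable (lborel \<Otimes>\<^sub>M (lborel \<Otimes>\<^sub>M F))"
    and q0: "\<And>x y \<omega>. (x, y) \<notin> D \<Longrightarrow> q x y \<omega> = 0"
  defines "H \<equiv> \<lambda>\<omega>. q (\<tau>\<^sub>1 \<omega>) (\<tau>\<^sub>2 \<omega>) \<omega> / (l (\<tau>\<^sub>1 \<omega>) * l (\<tau>\<^sub>2 \<omega>) * exp (c - L (\<tau>\<^sub>2 \<omega>)))"
  shows "integrable M H \<longleftrightarrow> integrable (lborel \<Otimes>\<^sub>M (lborel \<Otimes>\<^sub>M M)) (\<lambda>(x, y, \<omega>). q x y \<omega>)"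
    and "(LINT \<omega>|M. H \<omega>) = (LINT (x, y, \<omega>)|(lborel \<Otimes>\<^sub>M (lborel \<Otimes>\<^sub>M M)). q x y \<omega>)"
proof -
  interpret prob_space M by fact
  define R where "R = (borel \<Otimes>\<^sub>M borel :: (real \<times> real) measure)"
  define w :: "real \<times> real \<Rightarrow> real" where "w = (\<lambda>(x, y). indicator D (x, y) * (l x * l y * exp (c - L y)))"
  have Rl: "sets (lborel \<Otimes>\<^sub>M lborel) = sets R" unfolding R_def by (intro sets_pair_measure_cong) auto
  note [measurable_cong] = Rl
  have DR[measurable]: "D \<in> sets R" by (simp add: R_def)
  have w[measurable]: "w \<in> borel_measurable R" unfolding w_def R_def by measurable
  have w0: "0 \<le> w r" for r by (cases r) (simp add: w_def)
  let ?\<Phi> = "\<lambda>\<omega>. ((\<tau>\<^sub>1 \<omega>, \<tau>\<^sub>2 \<omega>), \<omega>)"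
  let ?PF = "distr M F (\<lambda>\<omega>. \<omega>)"
  have id[measurable]: "(\<lambda>\<omega>. \<omega>) \<in> measurable M F"
    using F by (auto simp: subalgebra_def measurable_def)
  have \<tau>R[measurable]: "(\<lambda>\<omega>. (\<tau>\<^sub>1 \<omega>, \<tau>\<^sub>2 \<omega>)) \<in> measurable M R" unfolding R_def by measurable
  have \<Phi>[measurable]: "?\<Phi> \<in> measurable M (R \<Otimes>\<^sub>M F)" by measurable
  interpret PF: prob_space ?PF by (rule prob_space_distr) simp
  have PFs: "sigma_finite_measure ?PF" by standard
  \<comment> \<open>\<open>H\<close> with the two times decoupled from \<omega>; \<open>H\<close> is
    recovered by substituting \<open>?\<Phi>\<close>.\<close>
  define \<phi> where "\<phi> = (\<lambda>p. q (fst (fst p)) (snd (fst p)) (snd p)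
     / (l (fst (fst p)) * l (snd (fst p)) * exp (c - L (snd (fst p)))))"
  have q1[measurable]: "(\<lambda>p. q (fst (fst p)) (snd (fst p)) (snd p)) \<in> borel_measurable (R \<Otimes>\<^sub>M F)"
  proof -
    have "(\<lambda>p. (\<lambda>(x, y, \<omega>). q x y \<omega>) (fst (fst p), snd (fst p), snd p)) \<in> borel_measurable (R \<Otimes>\<^sub>M F)"
      by (rule measurable_compose[OF _ q]) (simp add: R_def)
    then show ?thesis by simp
  qed
  have \<phi>[measurable]: "\<phi> \<in> borel_measurable (R \<Otimes>\<^sub>M F)"
    unfolding \<phi>_def using q1 unfolding R_def by measurable
  \<comment> \<open>The factor can be inserted because \<open>q\<close> vanishes off
    \<open>D\<close>; it confines the times to the region where their law is known.\<close>
  have H: "H \<omega> = indicator D (fst (?\<Phi> \<omega>)) *\<^sub>R \<phi> (?\<Phi> \<omega>)" for \<omega>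
    using q0[of "\<tau>\<^sub>1 \<omega>" "\<tau>\<^sub>2 \<omega>" \<omega>] by (auto simp: H_def \<phi>_def split: split_indicator)
  have w\<phi>: "w (fst p) *\<^sub>R \<phi> p = q (fst (fst p)) (snd (fst p)) (snd p)" for p
    using q0[of "fst (fst p)" "snd (fst p)" "snd p"] pos[of "fst (fst p)" "snd (fst p)"]
    by (cases "fst p \<in> D") (auto simp: \<phi>_def w_def case_prod_beta')
  let ?\<mu> = "density (distr M (R \<Otimes>\<^sub>M F) ?\<Phi>) (\<lambda>p. ennreal (indicator D (fst p)))"
  let ?\<nu> = "density ((lborel \<Otimes>\<^sub>M lborel) \<Otimes>\<^sub>M ?PF) (\<lambda>p. ennreal (w (fst p)))"
  have dPF: "density ?PF (\<lambda>_. 1) = ?PF" by (rule density_1)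
  have "?\<mu> = density (distr M R (\<lambda>\<omega>. (\<tau>\<^sub>1 \<omega>, \<tau>\<^sub>2 \<omega>)) \<Otimes>\<^sub>M ?PF) (\<lambda>(r, \<omega>). indicator D r * 1)"
    using ind by (simp add: R_def case_prod_beta' ennreal_indicator)
  also have "\<dots> = density (distr M R (\<lambda>\<omega>. (\<tau>\<^sub>1 \<omega>, \<tau>\<^sub>2 \<omega>))) (indicator D) \<Otimes>\<^sub>M density ?PF (\<lambda>_. 1)"
    by (rule pair_measure_density[symmetric]) (auto simp: dPF PFs)
  also have "\<dots> = density (lborel \<Otimes>\<^sub>M lborel) (\<lambda>r. ennreal (w r)) \<Otimes>\<^sub>M density ?PF (\<lambda>_. 1)"
    using law by (simp add: R_def w_def case_prod_beta')
  also have "\<dots> = density ((lborel \<Otimes>\<^sub>M lborel) \<Otimes>\<^sub>M ?PF) (\<lambda>(r, \<omega>). ennreal (w r) * 1)"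
    by (rule pair_measure_density) (auto simp: dPF PFs)
  finally have \<mu>\<nu>: "?\<mu> = ?\<nu>" by (simp add: case_prod_beta')
  \<comment> \<open>The decoupled copy of \<omega> carries only the sigma-algebra \<open>F\<close>;
    as the integrand is measurable for \<open>F\<close>, it may again be integrated against
    \<open>M\<close>.\<close>
  have "distr (lborel \<Otimes>\<^sub>M lborel) R (\<lambda>r. r) \<Otimes>\<^sub>M ?PF
      = distr ((lborel \<Otimes>\<^sub>M lborel) \<Otimes>\<^sub>M M) (R \<Otimes>\<^sub>M F) (\<lambda>(r, \<omega>). (r, \<omega>))"
    by (rule pair_measure_distr) (auto simp: PFs)
  moreover have "distr (lborel \<Otimes>\<^sub>M lborel) R (\<lambda>r. r) = lborel \<Otimes>\<^sub>M lborel"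
    by (rule distr_id2[OF Rl[symmetric], unfolded id_def])
  ultimately have PFM: "(lborel \<Otimes>\<^sub>M lborel) \<Otimes>\<^sub>M ?PF = distr ((lborel \<Otimes>\<^sub>M lborel) \<Otimes>\<^sub>M M) (R \<Otimes>\<^sub>M F) (\<lambda>p. p)"
    by (simp add: id_def)
  have idp[measurable]: "(\<lambda>p. p) \<in> measurable ((lborel \<Otimes>\<^sub>M lborel) \<Otimes>\<^sub>M M) (R \<Otimes>\<^sub>M F)"
  proof -
    have "(\<lambda>p. (fst p, snd p)) \<in> measurable ((lborel \<Otimes>\<^sub>M lborel) \<Otimes>\<^sub>M M) (R \<Otimes>\<^sub>M F)" by measurable
    then show ?thesis by simp
  qed
  have qM[measurable]: "(\<lambda>(x, y, \<omega>). q x y \<omega>) \<in> borel_measurable (lborel \<Otimes>\<^sub>M (lborel \<Otimes>\<^sub>M M))"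
  proof -
    have "(\<lambda>p. (fst p, fst (snd p), snd (snd p))) \<in> measurable (lborel \<Otimes>\<^sub>M (lborel \<Otimes>\<^sub>M M)) (lborel \<Otimes>\<^sub>M (lborel \<Otimes>\<^sub>M F))"
      by measurable
    from measurable_compose[OF this q] show ?thesis by (simp add: case_prod_beta')
  qed
  have assoc: "lborel \<Otimes>\<^sub>M (lborel \<Otimes>\<^sub>M M)
     = distr ((lborel \<Otimes>\<^sub>M lborel) \<Otimes>\<^sub>M M) (lborel \<Otimes>\<^sub>M (lborel \<Otimes>\<^sub>M M)) (\<lambda>((x, y), z). (x, (y, z)))"
    by (rule distr_pair_measure_assoc[symmetric]; standard)
  have sRF: "sets ((lborel \<Otimes>\<^sub>M lborel) \<Otimes>\<^sub>M ?PF) = sets (R \<Otimes>\<^sub>M F)"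
    using Rl by (intro sets_pair_measure_cong) simp_all
  have \<phi>PF: "\<phi> \<in> borel_measurable ((lborel \<Otimes>\<^sub>M lborel) \<Otimes>\<^sub>M ?PF)"
    "(\<lambda>p. w (fst p)) \<in> borel_measurable ((lborel \<Otimes>\<^sub>M lborel) \<Otimes>\<^sub>M ?PF)"
    by (simp_all add: measurable_cong_sets[OF sRF refl])
  have "integrable M H \<longleftrightarrow> integrable (distr M (R \<Otimes>\<^sub>M F) ?\<Phi>) (\<lambda>p. indicator D (fst p) *\<^sub>R \<phi> p)"
    unfolding H by (rule integrable_distr_eq[symmetric]) measurable
  also have "\<dots> \<longleftrightarrow> integrable ?\<mu> \<phi>"
    by (rule integrable_density[symmetric]) auto
  also have "\<dots> \<longleftrightarrow> integrable ((lborel \<Otimes>\<^sub>M lborel) \<Otimes>\<^sub>M ?PF) (\<lambda>p. w (fst p) *\<^sub>R \<phi> p)"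
    unfolding \<mu>\<nu> by (rule integrable_density) (auto simp: w0 \<phi>PF)
  also have "\<dots> \<longleftrightarrow> integrable ((lborel \<Otimes>\<^sub>M lborel) \<Otimes>\<^sub>M M) (\<lambda>p. q (fst (fst p)) (snd (fst p)) (snd p))"
    unfolding w\<phi> PFM by (rule integrable_distr_eq) auto
  also have "\<dots> \<longleftrightarrow> integrable (lborel \<Otimes>\<^sub>M (lborel \<Otimes>\<^sub>M M)) (\<lambda>(x, y, \<omega>). q x y \<omega>)"
    by (subst assoc, subst integrable_distr_eq) (auto simp: case_prod_beta' qM[unfolded case_prod_beta'])
  finally show "integrable M H \<longleftrightarrow> integrable (lborel \<Otimes>\<^sub>M (lborel \<Otimes>\<^sub>M M)) (\<lambda>(x, y, \<omega>). q x y \<omega>)" .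
  have "(LINT \<omega>|M. H \<omega>) = (LINT p|distr M (R \<Otimes>\<^sub>M F) ?\<Phi>. indicator D (fst p) *\<^sub>R \<phi> p)"
    unfolding H by (rule integral_distr[symmetric]) measurable
  also have "\<dots> = (LINT p|?\<mu>. \<phi> p)"
    by (rule integral_density[symmetric]) auto
  also have "\<dots> = (LINT p|((lborel \<Otimes>\<^sub>M lborel) \<Otimes>\<^sub>M ?PF). w (fst p) *\<^sub>R \<phi> p)"
    unfolding \<mu>\<nu> by (rule integral_density) (auto simp: w0 \<phi>PF)
  also have "\<dots> = (LINT p|((lborel \<Otimes>\<^sub>M lborel) \<Otimes>\<^sub>M M). q (fst (fst p)) (snd (fst p)) (snd p))"
    unfolding w\<phi> PFM by (rule integral_distr) auto
  also have "\<dots> = (LINT (x, y, \<omega>)|(lborel \<Otimes>\<^sub>M (lborel \<Otimes>\<^sub>M M)). q x y \<omega>)"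
    by (subst assoc, subst integral_distr) (auto simp: case_prod_beta' qM[unfolded case_prod_beta'])
  finally show "(LINT \<omega>|M. H \<omega>) = (LINT (x, y, \<omega>)|(lborel \<Otimes>\<^sub>M (lborel \<Otimes>\<^sub>M M)). q x y \<omega>)" .
qed

subsection \<open>Measurability of derivatives\<close>

text \<open>Differentiability makes the derivative a pointwise limit of difference quotients with
  step 1 / (n + 1), each of which is continuous in \<open>p\<close>.\<close>

lemma borel_measurable_deriv_along:
  fixes G :: "'b::{real_normed_vector, second_countable_topology} \<Rightarrow> real"
  assumes G: "\<And>p. G differentiable (at p)"
  shows "(\<lambda>p. deriv (\<lambda>h. G (p + h *\<^sub>R e)) 0) \<in> borel_measurable borel"
proof (rule borel_measurable_LIMSEQ_real)
  have cont: "continuous_on UNIV G"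
    using G by (simp add: continuous_at_imp_continuous_on differentiable_imp_continuous_within)
  show "(\<lambda>p. (G (p + (1 / real (Suc n)) *\<^sub>R e) - G p) * real (Suc n)) \<in> borel_measurable borel" for n
    by (intro borel_measurable_continuous_onI continuous_intros continuous_on_compose2[OF cont]) auto
  fix p
  have "(\<lambda>h. G (p + h *\<^sub>R e)) differentiable (at 0)"
    using differentiable_chain_at[of "\<lambda>h. p + h *\<^sub>R e" 0 G] G by (auto simp: o_def)
  then have "((\<lambda>h. G (p + h *\<^sub>R e)) has_real_derivative deriv (\<lambda>h. G (p + h *\<^sub>R e)) 0) (at 0)"
    by (metis DERIV_imp_deriv real_differentiableE)
  then have "((\<lambda>h. (G (p + h *\<^sub>R e) - G p) / h) \<longlongrightarrow> deriv (\<lambda>h. G (p + h *\<^sub>R e)) 0) (at 0)"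
    by (simp add: DERIV_def)
  moreover have "filterlim (\<lambda>n. 1 / real (Suc n)) (at 0) sequentially"
    by (rule filterlim_atI, rule LIMSEQ_Suc[OF lim_1_over_n]) simp
  ultimately have "(\<lambda>n. (G (p + (1 / real (Suc n)) *\<^sub>R e) - G p) / (1 / real (Suc n))) \<longlonglongrightarrow> deriv (\<lambda>h. G (p + h *\<^sub>R e)) 0"
    by (rule filterlim_compose)
  then show "(\<lambda>n. (G (p + (1 / real (Suc n)) *\<^sub>R e) - G p) * real (Suc n)) \<longlonglongrightarrow> deriv (\<lambda>h. G (p + h *\<^sub>R e)) 0"
    by simp
qed

lemma borel_measurable_vecI:
  fixes Z :: "'c \<Rightarrow> real^'n"
  assumes "\<And>i. (\<lambda>\<omega>. Z \<omega> $ i) \<in> borel_measurable N"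
  shows "Z \<in> borel_measurable N"
  using assms by (intro borel_measurable_euclidean_space[THEN iffD2]) (auto simp: Basis_vec_def inner_axis)

lemma borel_measurable_vec_nth:
  fixes Z :: "'c \<Rightarrow> 'b::{real_normed_vector, second_countable_topology}^'n"
  assumes "Z \<in> borel_measurable N"
  shows "(\<lambda>\<omega>. Z \<omega> $ i) \<in> borel_measurable N"
  by (rule measurable_compose[OF assms borel_measurable_continuous_onI]) (intro continuous_intros)

lemma adapted_measurable_vec:
  fixes X :: "real \<Rightarrow> 'a \<Rightarrow> real^'n"
  assumes "\<And>i. adapted_measurable M W s T (\<lambda>q \<omega>. X q \<omega> $ i)"
  shows "\<And>q. q \<in> {s..T} \<Longrightarrow> X q \<in> borel_measurable (augmented_filtration M W q)"
    and "(\<lambda>(q, \<omega>). indicator {s..T} q *\<^sub>R X q \<omega>) \<in> borel_measurable (lborel \<Otimes>\<^sub>M augmented_filtration M W T)"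
  using assms unfolding adapted_measurable_def
  by (auto intro!: borel_measurable_vecI simp: case_prod_beta')

context
  fixes f :: "real^'d \<Rightarrow> real \<Rightarrow> real^'r \<Rightarrow> real"
    and v0 :: "real^'d \<Rightarrow> real" and z0 :: "real^'d \<Rightarrow> real^'r"
  assumes v0: "\<And>x. v0 differentiable (at x)" and z0: "\<And>x. z0 differentiable (at x)"
    and f: "\<And>p. (\<lambda>(x, v, z). f x v z) differentiable (at p)"
begin

lemma borel_measurable_v0: "v0 \<in> borel_measurable borel" and borel_measurable_z0: "z0 \<in> borel_measurable borel"
  by (auto intro!: borel_measurable_continuous_onI continuous_at_imp_continuous_on
      simp: v0 z0 differentiable_imp_continuous_within)

lemma borel_measurable_graph: "(\<lambda>x. (x, v0 x, z0 x)) \<in> borel_measurable borel"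
  using borel_measurable_v0 borel_measurable_z0 by (intro borel_measurable_Pair) auto

lemma borel_measurable_driver: "(\<lambda>x. f x (v0 x) (z0 x)) \<in> borel_measurable borel"
proof -
  have "(\<lambda>(x, v, z). f x v z) \<in> borel_measurable borel"
    by (auto intro!: borel_measurable_continuous_onI continuous_at_imp_continuous_on
      simp: f differentiable_imp_continuous_within)
  from measurable_compose[OF borel_measurable_graph this] show ?thesis by simp
qed

text \<open>Here and in the next two lemmas a partial derivative of \<open>f\<close> is a
  directional derivative on the product space, composed with the graph of the order-zero
  solution.\<close>

lemma borel_measurable_d_x: "(\<lambda>x. d_x i f x (v0 x) (z0 x)) \<in> borel_measurable borel"
  using measurable_compose[OF borel_measurable_graph borel_measurable_deriv_along[OF f, of "(axis i 1, 0, 0)"]]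
  by (simp add: d_x_def[abs_def] partial_def)

lemma borel_measurable_d_v: "(\<lambda>x. d_v f x (v0 x) (z0 x)) \<in> borel_measurable borel"
  using measurable_compose[OF borel_measurable_graph borel_measurable_deriv_along[OF f, of "(0, 1, 0)"]]
  by (simp add: d_v_def[abs_def] deriv_shift_0[of _ "v0 _"] o_def)

lemma borel_measurable_d_z: "(\<lambda>x. d_z a f x (v0 x) (z0 x)) \<in> borel_measurable borel"
  using measurable_compose[OF borel_measurable_graph borel_measurable_deriv_along[OF f, of "(0, 0, axis a 1)"]]
  by (simp add: d_z_def[abs_def] partial_def)

lemma borel_measurable_nabla: "(\<lambda>x. nabla v0 z0 i f x (v0 x) (z0 x)) \<in> borel_measurable borel"
proof -
  have 1: "partial i v0 \<in> borel_measurable borel"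
    using borel_measurable_deriv_along[OF v0] by (simp add: partial_def[abs_def])
  have "(\<lambda>y. z0 y $ a) differentiable (at x)" for a x
    using bounded_linear.has_derivative[OF bounded_linear_vec_nth] z0 unfolding differentiable_def by blast
  then have 2: "partial i (\<lambda>y. z0 y $ a) \<in> borel_measurable borel" for a
    using borel_measurable_deriv_along[of "\<lambda>y. z0 y $ a"] by (simp add: partial_def[abs_def])
  show ?thesis
    unfolding nabla_def
    using 1 2 borel_measurable_d_x borel_measurable_d_v borel_measurable_d_z
    by (intro borel_measurable_add borel_measurable_times borel_measurable_sum) auto
qed

end

subsection \<open>The particle representation\<close>

theorem proposition3:
  fixes M :: "'a measure" and T t :: real
    and W :: "real \<Rightarrow> 'a \<Rightarrow> real^'r"
    and \<gamma>0 :: "real^'d \<Rightarrow> real^'d" and \<gamma> :: "real^'d \<Rightarrow> real^'r^'d"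
    and X :: "real \<Rightarrow> 'a \<Rightarrow> real^'d" and Y :: "real \<Rightarrow> real \<Rightarrow> 'a \<Rightarrow> real^'d^'d"
    and f :: "real^'d \<Rightarrow> real \<Rightarrow> real^'r \<Rightarrow> real"
    and \<Psi> v0 :: "real^'d \<Rightarrow> real" and z0 :: "real^'d \<Rightarrow> real^'r"
    and Df :: "real \<Rightarrow> real \<Rightarrow> 'a \<Rightarrow> real^'r"
    and V1 :: "real \<Rightarrow> 'a \<Rightarrow> real" and Z1 :: "real \<Rightarrow> 'a \<Rightarrow> real^'r" and V2 :: "'a \<Rightarrow> real"
    and lam :: "real \<Rightarrow> real" and \<tau>\<^sub>1 \<tau>\<^sub>2 :: "'a \<Rightarrow> real"
  assumes "prob_space M" and "0 \<le> t" and "t < T"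
    and "brownian_motion M T W"
    \<comment> \<open>regularity of the coefficients\<close>
    and "\<And>x. \<gamma>0 differentiable (at x)" and "\<And>x. \<gamma> differentiable (at x)"
    and "\<And>x. v0 differentiable (at x)" and "\<And>x. z0 differentiable (at x)"
    and "\<And>p. (\<lambda>(x, v, z). f x v z) differentiable (at p)"
    \<comment> \<open>the forward process\<close>
    and "sde_unique_solution M W 0 T (\<lambda>_ _. \<gamma>0) (\<lambda>_ _. \<gamma>) (X 0) X"
    \<comment> \<open>the solution of order zero\<close>
    and "ito_process M W 0 T (\<lambda>_ _. 0) (\<lambda>s \<omega>. z0 (X s \<omega>)) (\<lambda>s \<omega>. v0 (X s \<omega>))"
    and "AE \<omega> in M. v0 (X T \<omega>) = \<Psi> (X T \<omega>)"
    \<comment> \<open>the stochastic flow\<close>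
    and "stochastic_flow M T W \<gamma>0 \<gamma> X Y"
    and "(\<lambda>(s, u, \<omega>). (if 0 \<le> s \<and> s \<le> u \<and> u \<le> T then Y s u \<omega> else 0))
           \<in> borel_measurable (lborel \<Otimes>\<^sub>M lborel \<Otimes>\<^sub>M augmented_filtration M W T)"
    \<comment> \<open>the Malliavin derivative of \<open>X\<close>\<close>
    and "\<And>u i. u \<in> {0..T} \<Longrightarrow>
           has_malliavin_derivative M T W (\<lambda>\<omega>. X u \<omega> $ i)
             (\<lambda>s \<omega>. if s \<le> u then (Y s u \<omega> ** \<gamma> (X s \<omega>)) $ i else 0)"
    \<comment> \<open>\<open>Df u s\<close> is the Malliavin derivative at \<open>s\<close> of the driver at \<open>u\<close>, given by the chain rule\<close>
    and "\<And>u. u \<in> {0..T} \<Longrightarrow> has_malliavin_derivative M T W (along v0 z0 X f u) (Df u)"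
    and "(\<lambda>(u, s, \<omega>). indicator ({0..T} \<times> {0..T}) (u, s) *\<^sub>R Df u s \<omega>)
           \<in> borel_measurable (lborel \<Otimes>\<^sub>M lborel \<Otimes>\<^sub>M M)"
    and "\<And>u. u \<in> {0..T} \<Longrightarrow>
           AE (s, \<omega>) in lborel \<Otimes>\<^sub>M M. s \<in> {0..T} \<longrightarrow>
             Df u s \<omega> = (\<Sum>i\<in>UNIV. along v0 z0 X (nabla v0 z0 i f) u \<omega> *\<^sub>R
                           (if s \<le> u then (Y s u \<omega> ** \<gamma> (X s \<omega>)) $ i else 0))"
    \<comment> \<open>the solution of order one\<close>
    and "\<And>s. s \<in> {0..T} \<Longrightarrow>
           is_integral_of_cond_exp M (augmented_filtration M W s) s T (along v0 z0 X f) (V1 s)"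
    and "AE s in lborel. s \<in> {0..T} \<longrightarrow> (\<forall>a.
           is_integral_of_cond_exp M (augmented_filtration M W s) s T
             (\<lambda>u \<omega>. Df u s \<omega> $ a) (\<lambda>\<omega>. Z1 s \<omega> $ a))"
    \<comment> \<open>the correction of order two\<close>
    and "is_integral_of_cond_exp M (augmented_filtration M W t) t T
           (\<lambda>u \<omega>. V1 u \<omega> * along v0 z0 X (d_v f) u \<omega>
                    + (\<Sum>a\<in>UNIV. Z1 u \<omega> $ a * along v0 z0 X (d_z a f) u \<omega>)) V2"
    \<comment> \<open>the interaction times\<close>
    and "set_integrable lborel {0..T} lam" and "\<And>s. s \<in> {0..T} \<Longrightarrow> 0 < lam s"
    and "interaction_times M T W lam t \<tau>\<^sub>1 \<tau>\<^sub>2"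
    \<comment> \<open>integrability of the two integrands of the particle representation\<close>
    and "integrable M (\<lambda>\<omega>. indicator {\<omega>. \<tau>\<^sub>1 \<omega> < \<tau>\<^sub>2 \<omega> \<and> \<tau>\<^sub>2 \<omega> < T} \<omega>
           * hat lam v0 z0 X (d_v f) t (\<tau>\<^sub>1 \<omega>) \<omega> * hat lam v0 z0 X f (\<tau>\<^sub>1 \<omega>) (\<tau>\<^sub>2 \<omega>) \<omega>)"
    and "integrable M (\<lambda>\<omega>. indicator {\<omega>. \<tau>\<^sub>1 \<omega> < \<tau>\<^sub>2 \<omega> \<and> \<tau>\<^sub>2 \<omega> < T} \<omega>
           * (\<Sum>a\<in>UNIV. \<Sum>i\<in>UNIV. hat lam v0 z0 X (d_z a f) t (\<tau>\<^sub>1 \<omega>) \<omega>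
               * (Y (\<tau>\<^sub>1 \<omega>) (\<tau>\<^sub>2 \<omega>) \<omega> ** \<gamma> (X (\<tau>\<^sub>1 \<omega>) \<omega>)) $ i $ a
               * hat lam v0 z0 X (nabla v0 z0 i f) (\<tau>\<^sub>1 \<omega>) (\<tau>\<^sub>2 \<omega>) \<omega>))"
  shows "AE \<omega> in M. V2 \<omega> =
      indicator {\<omega>. t < \<tau>\<^sub>1 \<omega>} \<omega> * real_cond_exp M (augmented_filtration M W t)
        (\<lambda>\<omega>. indicator {\<omega>. \<tau>\<^sub>1 \<omega> < \<tau>\<^sub>2 \<omega> \<and> \<tau>\<^sub>2 \<omega> < T} \<omega>
           * hat lam v0 z0 X (d_v f) t (\<tau>\<^sub>1 \<omega>) \<omega> * hat lam v0 z0 X f (\<tau>\<^sub>1 \<omega>) (\<tau>\<^sub>2 \<omega>) \<omega>) \<omega>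
    + indicator {\<omega>. t < \<tau>\<^sub>1 \<omega>} \<omega> * real_cond_exp M (augmented_filtration M W t)
        (\<lambda>\<omega>. indicator {\<omega>. \<tau>\<^sub>1 \<omega> < \<tau>\<^sub>2 \<omega> \<and> \<tau>\<^sub>2 \<omega> < T} \<omega>
           * (\<Sum>a\<in>UNIV. \<Sum>i\<in>UNIV. hat lam v0 z0 X (d_z a f) t (\<tau>\<^sub>1 \<omega>) \<omega>
               * (Y (\<tau>\<^sub>1 \<omega>) (\<tau>\<^sub>2 \<omega>) \<omega> ** \<gamma> (X (\<tau>\<^sub>1 \<omega>) \<omega>)) $ i $ a
               * hat lam v0 z0 X (nabla v0 z0 i f) (\<tau>\<^sub>1 \<omega>) (\<tau>\<^sub>2 \<omega>) \<omega>)) \<omega>"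

proof -
  interpret prob_space M by fact
  note tT = \<open>0 \<le> t\<close> \<open>t < T\<close>
  let ?F = "augmented_filtration M W"
  have Wm: "W u \<in> borel_measurable M" if "u \<in> {0..T}" for u
    using \<open>brownian_motion M T W\<close> that by (simp add: brownian_motion_def)
  have FM: "subalgebra M (?F s)" if "s \<le> T" for s
    by (rule subalgebra_augmented_filtration) (use Wm that in auto)
  have FF: "subalgebra (?F u) (?F s)" if "s \<le> u" for s u
    by (rule subalgebra_augmented_filtration_mono[OF that])

  \<comment> \<open>outside \<open>[0, T]\<close> the function \<open>lam\<close> is arbitrary\<close>
  define l where "l u = indicator {t..T} u * lam u" for u
  have lam_t: "set_integrable lborel {t..T} lam"
    by (rule set_integrable_subset[OF \<open>set_integrable lborel {0..T} lam\<close>]) (use tT in auto)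
  have lam_pos: "0 < lam u" if "u \<in> {t..T}" for u
    using assms(23)[of u] tT that by simp
  interpret intensity l
  proof
    show "integrable lborel l" using lam_t by (simp add: set_integrable_def l_def[abs_def])
    show "0 \<le> l u" for u using lam_pos[of u] by (auto simp: l_def split: split_indicator)
  qed
  have l_eq: "l u = lam u" if "t \<le> u" "u \<le> T" for u using that by (simp add: l_def)
  have Lam: "(LINT u:{a..b}|lborel. lam u) = L b - L a" if "t \<le> a" "a \<le> b" "b \<le> T" for a b
    unfolding L_diff[OF that(2), symmetric] set_lebesgue_integral_def
    using that by (intro Bochner_Integration.integral_cong) (auto simp: l_def split: split_indicator)

  \<comment> \<open>Law of the interaction times and their independence of the filtration\<close>
  have \<tau>[measurable]: "\<tau>\<^sub>1 \<in> borel_measurable M" "\<tau>\<^sub>2 \<in> borel_measurable M"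
    and \<tau>_less: "AE \<omega> in M. \<tau>\<^sub>1 \<omega> < \<tau>\<^sub>2 \<omega>"
    and ind0: "indep_set (sets (vimage_algebra (space M) (\<lambda>\<omega>. (\<tau>\<^sub>1 \<omega>, \<tau>\<^sub>2 \<omega>)) borel))
       (sets (natural_filtration M W T))"
    and P1: "\<And>s. s\<in>{t..T} \<Longrightarrow> measure M {\<omega>\<in>space M. s < \<tau>\<^sub>1 \<omega>} = exp (- (LINT u:{t..s}|lborel. lam u))"
    and P2: "\<And>s. s\<in>{t..T} \<Longrightarrow> AE \<omega> in M. \<tau>\<^sub>1 \<omega> < T \<and> \<tau>\<^sub>1 \<omega> \<le> s \<longrightarrow>
        real_cond_exp M (vimage_algebra (space M) \<tau>\<^sub>1 borel)
          (indicator {\<omega>\<in>space M. s < \<tau>\<^sub>2 \<omega>}) \<omega>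
        = exp (- (LINT u:{\<tau>\<^sub>1 \<omega>..s}|lborel. lam u))"
    using \<open>interaction_times M T W lam t \<tau>\<^sub>1 \<tau>\<^sub>2\<close> unfolding interaction_times_def by blast+
  have P1': "measure M {\<omega>\<in>space M. s < \<tau>\<^sub>1 \<omega>} = exp (L t - L s)" if "s \<in> {t..T}" for s
    using P1[OF that] Lam[of t s] that by simp
  \<comment> \<open>The intensity is cut off below t, so the formula in terms of \<open>L\<close> is
    claimed only for \<open>t < \<tau>\<^sub>1 \<omega>\<close>.\<close>
  have P2': "AE \<omega> in M. t < \<tau>\<^sub>1 \<omega> \<and> \<tau>\<^sub>1 \<omega> < s \<longrightarrow>
        real_cond_exp M (vimage_algebra (space M) \<tau>\<^sub>1 borel)
          (indicator {\<omega>\<in>space M. s < \<tau>\<^sub>2 \<omega>}) \<omega> = exp (L (\<tau>\<^sub>1 \<omega>) - L s)" if "s \<in> {t..T}" for s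
    using P2[OF that] by eventually_elim (use that Lam[of _ s] in auto)
  define D where "D = {(x, y). t < x \<and> x < y \<and> y \<le> T}"
  have law: "density (distr M (borel \<Otimes>\<^sub>M borel) (\<lambda>\<omega>. (\<tau>\<^sub>1 \<omega>, \<tau>\<^sub>2 \<omega>))) (indicator D)
       = density (lborel \<Otimes>\<^sub>M lborel) (\<lambda>(x, y). ennreal (indicator D (x, y) * (l x * l y * exp (L t - L y))))"
    unfolding D_def
    by (rule interaction_times_law[OF \<open>prob_space M\<close> _ \<tau> \<tau>_less P1' P2']) (use tT in auto)
  have ind: "distr M (borel \<Otimes>\<^sub>M borel) (\<lambda>\<omega>. (\<tau>\<^sub>1 \<omega>, \<tau>\<^sub>2 \<omega>)) \<Otimes>\<^sub>M distr M (?F T) (\<lambda>\<omega>. \<omega>)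
        = distr M ((borel \<Otimes>\<^sub>M borel) \<Otimes>\<^sub>M ?F T) (\<lambda>\<omega>. ((\<tau>\<^sub>1 \<omega>, \<tau>\<^sub>2 \<omega>), \<omega>))"
    by (rule distr_Pair_indep_subalgebra)
      (use indep_set_augmented_filtration[OF ind0] FM[of T] in \<open>auto simp: borel_prod\<close>)
  have "D = {p \<in> space (borel \<Otimes>\<^sub>M borel). t < fst p \<and> fst p < snd p \<and> snd p \<le> T}"
    by (auto simp: D_def space_pair_measure)
  then have Dm: "D \<in> sets (borel \<Otimes>\<^sub>M borel)" by simp
  have Dpos: "0 < l x \<and> 0 < l y" if "(x, y) \<in> D" for x y
    using that lam_pos by (auto simp: D_def l_eq)
  \<comment> \<open>The survival probability at s = t is 1, so the indicator in front of the
    conditional expectations is almost surely 1.\<close>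
  have \<tau>_gt: "AE \<omega> in M. t < \<tau>\<^sub>1 \<omega>"
    using P1'[of t] tT by (auto intro!: AE_prob_1 simp: prob_Collect_eq_1[symmetric])

  \<comment> \<open>The integrand at deterministic times and its measurability\<close>
  define f0 where "f0 x = f x (v0 x) (z0 x)" for x
  define fv where "fv x = d_v f x (v0 x) (z0 x)" for x
  define fz where "fz a x = d_z a f x (v0 x) (z0 x)" for a x
  define N where "N i x = nabla v0 z0 i f x (v0 x) (z0 x)" for i x
  note reg = \<open>\<And>x. v0 differentiable (at x)\<close> \<open>\<And>x. z0 differentiable (at x)\<close>
    \<open>\<And>p. (\<lambda>(x, v, z). f x v z) differentiable (at p)\<close>
  have [measurable]: "f0 \<in> borel_measurable borel" "fv \<in> borel_measurable borel"
    "\<And>a. fz a \<in> borel_measurable borel" "\<And>i. N i \<in> borel_measurable borel"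
    unfolding f0_def[abs_def] fv_def[abs_def] fz_def[abs_def] N_def[abs_def]
    by (rule borel_measurable_driver[OF reg] borel_measurable_d_v[OF reg]
        borel_measurable_d_z[OF reg] borel_measurable_nabla[OF reg])+
  have \<gamma>m[measurable]: "\<gamma> \<in> borel_measurable borel"
    by (intro borel_measurable_continuous_onI continuous_at_imp_continuous_on ballI
        differentiable_imp_continuous_within assms(6))
  have along: "along v0 z0 X f s \<omega> = f0 (X s \<omega>)" "along v0 z0 X (d_v f) s \<omega> = fv (X s \<omega>)"
    "along v0 z0 X (d_z a f) s \<omega> = fz a (X s \<omega>)" "along v0 z0 X (nabla v0 z0 i f) s \<omega> = N i (X s \<omega>)"
    for s \<omega> a i
    by (simp_all add: along_def f0_def fv_def fz_def N_def)
  have "adapted_measurable M W 0 T (\<lambda>u \<omega>. X u \<omega> $ i)" for i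
    using assms(10) by (simp add: sde_unique_solution_def sde_solution_def ito_process_def)
  note X = adapted_measurable_vec[OF this]
  \<comment> \<open>\<open>X\<close> and \<open>Y\<close> are jointly measurable only after being cut off outside \<open>[0, T]\<close>\<close>
  define Xh where "Xh q \<omega> = indicator {0..T} q *\<^sub>R X q \<omega>" for q \<omega>
  define Yh where "Yh s u \<omega> = (if 0 \<le> s \<and> s \<le> u \<and> u \<le> T then Y s u \<omega> else 0)" for s u \<omega>
  have Xh: "Xh q \<omega> = X q \<omega>" if "0 \<le> q" "q \<le> T" for q \<omega> using that by (simp add: Xh_def)
  have Yh: "Yh s u \<omega> = Y s u \<omega>" if "0 \<le> s" "s \<le> u" "u \<le> T" for s u \<omega> using that by (simp add: Yh_def)
  let ?FT = "lborel \<Otimes>\<^sub>M (lborel \<Otimes>\<^sub>M ?F T) :: (real \<times> real \<times> 'a) measure"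
  have Xm: "(\<lambda>p. Xh (fst p) (snd (snd p))) \<in> borel_measurable ?FT" "(\<lambda>p. Xh (fst (snd p)) (snd (snd p))) \<in> borel_measurable ?FT"
  proof -
    have m1: "(\<lambda>p. (fst p, snd (snd p))) \<in> measurable ?FT (lborel \<Otimes>\<^sub>M ?F T)" by measurable
    have m2: "(\<lambda>p. (fst (snd p), snd (snd p))) \<in> measurable ?FT (lborel \<Otimes>\<^sub>M ?F T)" by measurable
    show "(\<lambda>p. Xh (fst p) (snd (snd p))) \<in> borel_measurable ?FT"
      using measurable_compose[OF m1 X(2)] by (simp add: Xh_def case_prod_beta')
    show "(\<lambda>p. Xh (fst (snd p)) (snd (snd p))) \<in> borel_measurable ?FT"
      using measurable_compose[OF m2 X(2)] by (simp add: Xh_def case_prod_beta')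
  qed
  have Ym: "(\<lambda>p. Yh (fst p) (fst (snd p)) (snd (snd p))) \<in> borel_measurable ?FT"
    using assms(14) by (simp add: Yh_def[abs_def] case_prod_beta')
  \<comment> \<open>On the triangle this is component \<open>a\<close> of the Malliavin derivative
    at \<open>s\<close> of the \<open>i\<close>-th coordinate of \<open>X u\<close>.\<close>
  define m where "m s u \<omega> i a = (Yh s u \<omega> ** \<gamma> (Xh s \<omega>)) $ i $ a" for s u \<omega> i a
  have mm: "(\<lambda>p. m (fst p) (fst (snd p)) (snd (snd p)) i a) \<in> borel_measurable ?FT" for i a
    unfolding m_def matrix_matrix_mult_def vec_lambda_beta
    by (intro borel_measurable_sum borel_measurable_times borel_measurable_vec_nth Ym
        measurable_compose[OF Xm(1) \<gamma>m])
  have Xm0: "(\<lambda>p. g (Xh (fst p) (snd (snd p)))) \<in> borel_measurable ?FT"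
     "(\<lambda>p. g (Xh (fst (snd p)) (snd (snd p)))) \<in> borel_measurable ?FT"
    if "g \<in> borel_measurable borel" for g :: "real^'d \<Rightarrow> real"
    using measurable_compose[OF Xm(1) that] measurable_compose[OF Xm(2) that] by simp_all
  define E where "E s u \<omega> = fv (Xh s \<omega>) * f0 (Xh u \<omega>)
     + (\<Sum>a\<in>UNIV. \<Sum>i\<in>UNIV. fz a (Xh s \<omega>) * m s u \<omega> i a * N i (Xh u \<omega>))" for s u \<omega>
  \<comment> \<open>The strict inequalities are those of the particle indicator; the closed
    intervals of the conditional expectations add only null sets.\<close>
  define q where "q s u \<omega> = (if t < s \<and> s < u \<and> u < T then E s u \<omega> else 0)" for s u \<omega>
  have Em: "(\<lambda>p. E (fst p) (fst (snd p)) (snd (snd p))) \<in> borel_measurable ?FT"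
    unfolding E_def
    by (intro borel_measurable_add borel_measurable_sum borel_measurable_times Xm0 mm) measurable
  have qm: "(\<lambda>(s, u, \<omega>). q s u \<omega>) \<in> borel_measurable ?FT"
    unfolding q_def case_prod_beta' by (rule measurable_If[OF Em]) measurable
  have q0: "q x y \<omega> = 0" if "(x, y) \<notin> D" for x y \<omega>
    using that by (auto simp: q_def D_def)

  \<comment> \<open>The particle integrand as a weighted sample of \<open>q\<close>\<close>
  let ?LM = "lborel \<Otimes>\<^sub>M (lborel \<Otimes>\<^sub>M M) :: (real \<times> real \<times> 'a) measure"
  define H1 where "H1 = (\<lambda>\<omega>. indicator {\<omega>. \<tau>\<^sub>1 \<omega> < \<tau>\<^sub>2 \<omega> \<and> \<tau>\<^sub>2 \<omega> < T} \<omega>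
           * hat lam v0 z0 X (d_v f) t (\<tau>\<^sub>1 \<omega>) \<omega> * hat lam v0 z0 X f (\<tau>\<^sub>1 \<omega>) (\<tau>\<^sub>2 \<omega>) \<omega>)"
  define H2 where "H2 = (\<lambda>\<omega>. indicator {\<omega>. \<tau>\<^sub>1 \<omega> < \<tau>\<^sub>2 \<omega> \<and> \<tau>\<^sub>2 \<omega> < T} \<omega>
           * (\<Sum>a\<in>UNIV. \<Sum>i\<in>UNIV. hat lam v0 z0 X (d_z a f) t (\<tau>\<^sub>1 \<omega>) \<omega>
               * (Y (\<tau>\<^sub>1 \<omega>) (\<tau>\<^sub>2 \<omega>) \<omega> ** \<gamma> (X (\<tau>\<^sub>1 \<omega>) \<omega>)) $ i $ a
               * hat lam v0 z0 X (nabla v0 z0 i f) (\<tau>\<^sub>1 \<omega>) (\<tau>\<^sub>2 \<omega>) \<omega>))"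
  have H1: "integrable M H1" using assms(25) by (simp add: H1_def)
  have H2: "integrable M H2" using assms(26) by (simp add: H2_def)
  define H where "H \<omega> = q (\<tau>\<^sub>1 \<omega>) (\<tau>\<^sub>2 \<omega>) \<omega> / (l (\<tau>\<^sub>1 \<omega>) * l (\<tau>\<^sub>2 \<omega>) * exp (L t - L (\<tau>\<^sub>2 \<omega>)))" for \<omega>
  have H_eq: "AE \<omega> in M. H1 \<omega> + H2 \<omega> = H \<omega>"
    using \<tau>_gt
  proof eventually_elim
    fix \<omega> assume gt: "t < \<tau>\<^sub>1 \<omega>"
    define s u where "s = \<tau>\<^sub>1 \<omega>" and "u = \<tau>\<^sub>2 \<omega>"
    show "H1 \<omega> + H2 \<omega> = H \<omega>"
    proof (cases "s < u \<and> u < T")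
      case True
      then have su: "t < s" "s < u" "u < T" using gt by (auto simp: s_def)
      define k where "k = 1 / (l s * l u * exp (L t - L u))"
      have pos: "0 < l s" "0 < l u" using Dpos[of s u] su by (auto simp: D_def)
      have hat1: "hat lam v0 z0 X g t s \<omega> = 1 / l s * exp (L s - L t) * along v0 z0 X g s \<omega>" for g
        using su Lam[of t s] by (simp add: hat_def l_eq)
      have hat2: "hat lam v0 z0 X g s u \<omega> = 1 / l u * exp (L u - L s) * along v0 z0 X g u \<omega>" for g
        using su Lam[of s u] by (simp add: hat_def l_eq)
      \<comment> \<open>The exponentials of the two prefactors telescope, leaving the inverse of the
        joint density at (s, u).\<close>
      have k: "(1 / l s * exp (L s - L t)) * (1 / l u * exp (L u - L s)) = k"
        using pos by (simp add: k_def field_simps flip: exp_add)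
      have hat12: "hat lam v0 z0 X g t s \<omega> * hat lam v0 z0 X g' s u \<omega>
          = k * (along v0 z0 X g s \<omega> * along v0 z0 X g' u \<omega>)" for g g'
        unfolding hat1 hat2 k[symmetric] by (simp only: mult_ac)
      have hat13: "hat lam v0 z0 X g t s \<omega> * x * hat lam v0 z0 X g' s u \<omega>
          = k * (along v0 z0 X g s \<omega> * x * along v0 z0 X g' u \<omega>)" for g g' x
        unfolding hat1 hat2 k[symmetric] by (simp only: mult_ac)
      have ind1: "indicator {\<omega>. \<tau>\<^sub>1 \<omega> < \<tau>\<^sub>2 \<omega> \<and> \<tau>\<^sub>2 \<omega> < T} \<omega> = (1::real)"
        using True by (simp add: s_def u_def)
      have "H1 \<omega> = k * (fv (X s \<omega>) * f0 (X u \<omega>))"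
        unfolding H1_def ind1 s_def[symmetric] u_def[symmetric] by (simp add: hat12 along)
      moreover have "H2 \<omega> = k * (\<Sum>a\<in>UNIV. \<Sum>i\<in>UNIV. fz a (X s \<omega>) * m s u \<omega> i a * N i (X u \<omega>))"
        unfolding H2_def ind1 s_def[symmetric] u_def[symmetric]
        using su tT by (simp add: hat13 along m_def Xh Yh sum_distrib_left)
      moreover have "H \<omega> = k * E s u \<omega>"
        unfolding H_def s_def[symmetric] u_def[symmetric] using su by (simp add: q_def k_def)
      moreover have "Xh s \<omega> = X s \<omega>" "Xh u \<omega> = X u \<omega>" using su tT by (auto simp: Xh)
      ultimately show ?thesis by (simp add: E_def distrib_left)
    next
      case False
      then show ?thesis by (auto simp: H1_def H2_def H_def q_def s_def u_def)
    qed
  qed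
  have Hm: "H \<in> borel_measurable M"
  proof -
    have [measurable]: "(\<lambda>\<omega>. \<omega>) \<in> measurable M (?F T)"
      using FM[of T] by (auto simp: subalgebra_def measurable_def)
    have "(\<lambda>\<omega>. (\<tau>\<^sub>1 \<omega>, \<tau>\<^sub>2 \<omega>, \<omega>)) \<in> measurable M ?FT" by measurable
    from measurable_compose[OF this qm]
    have [measurable]: "(\<lambda>\<omega>. q (\<tau>\<^sub>1 \<omega>) (\<tau>\<^sub>2 \<omega>) \<omega>) \<in> borel_measurable M" by simp
    show ?thesis unfolding H_def by measurable
  qed
  have Hi: "integrable M H"
    by (rule integrable_cong_AE_imp[OF Bochner_Integration.integrable_add[OF H1 H2] Hm])
      (use H_eq in \<open>auto elim!: eventually_mono\<close>)
  have qi: "integrable ?LM (\<lambda>(s, u, \<omega>). q s u \<omega>)"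
    using integral_over_interaction_times(1)[OF \<open>prob_space M\<close> FM[of T] \<tau> ind law Dm Dpos qm q0] Hi
    by (simp add: H_def[abs_def])

  \<comment> \<open>The order-two integrand as an iterated conditional expectation\<close>
  define A where "A j s \<omega> = (case j of None \<Rightarrow> fv (X s \<omega>) | Some a \<Rightarrow> fz a (X s \<omega>))" for j s \<omega>
  define b where "b j s u \<omega> = (case j of None \<Rightarrow> along v0 z0 X f u \<omega> | Some a \<Rightarrow> Df u s \<omega> $ a)" for j s u \<omega>
  define R where "R j s \<omega> = (case j of None \<Rightarrow> V1 s \<omega> | Some a \<Rightarrow> Z1 s \<omega> $ a)" for j s \<omega>
  have sum_option: "(\<Sum>j\<in>UNIV. h j) = h None + (\<Sum>a\<in>UNIV. h (Some a))" for h :: "'r option \<Rightarrow> real"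
    by (simp add: UNIV_option_conv sum.reindex)
  have Am: "A j s \<in> borel_measurable (?F s)" if "s \<in> {t..T}" for j s
  proof -
    have "X s \<in> borel_measurable (?F s)" using X(1)[of s] that tT by simp
    note [measurable] = this
    show ?thesis unfolding A_def[abs_def] by (cases j) (simp_all, measurable)
  qed
  have R: "AE s in lborel. s \<in> {t..T} \<longrightarrow> (\<forall>j\<in>UNIV. is_integral_of_cond_exp M (?F s) s T (b j s) (R j s))"
    using assms(20)
  proof (eventually_elim, intro impI ballI)
    fix s j
    assume *: "s \<in> {0..T} \<longrightarrow> (\<forall>a. is_integral_of_cond_exp M (?F s) s T (\<lambda>u \<omega>. Df u s \<omega> $ a) (\<lambda>\<omega>. Z1 s \<omega> $ a))"
      and "s \<in> {t..T}"
    then have s: "s \<in> {0..T}" using tT by auto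
    show "is_integral_of_cond_exp M (?F s) s T (b j s) (R j s)"
      using * s assms(19)[OF s] by (cases j) (simp_all add: b_def[abs_def] R_def[abs_def])
  qed

  \<comment> \<open>The chain rule holds for every \<open>u\<close> and almost every (s, \<omega>),
    while the driver is needed at almost every \<open>s\<close>. The discrepancy \<open>Z\<close> is
    set to 0 off the triangle, where nothing is claimed, and the null sets are exchanged.\<close>
  have ex: "AE s in lborel. AE (u, \<omega>) in lborel \<Otimes>\<^sub>M M. 0 \<le> s \<and> s \<le> u \<and> u \<le> T \<longrightarrow>
      (\<forall>a. Df u s \<omega> $ a = (\<Sum>i\<in>UNIV. m s u \<omega> i a * N i (Xh u \<omega>)))"
  proof -
    define Z where "Z u s \<omega> = (if 0 \<le> s \<and> s \<le> u \<and> u \<le> T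
       then ennreal (norm (indicator ({0..T} \<times> {0..T}) (u, s) *\<^sub>R Df u s \<omega> - (\<chi> a. \<Sum>i\<in>UNIV. m s u \<omega> i a * N i (Xh u \<omega>)))) else 0)" for u s \<omega>
    have Zm: "(\<lambda>(u, s, \<omega>). Z u s \<omega>) \<in> borel_measurable ?LM"
    proof -
      have [measurable]: "(\<lambda>\<omega>. \<omega>) \<in> measurable M (?F T)"
        using FM[of T] by (auto simp: subalgebra_def measurable_def)
      have sw: "(\<lambda>p. (fst (snd p), fst p, snd (snd p))) \<in> measurable ?LM ?FT" by measurable
      have "(\<lambda>p. \<Sum>i\<in>UNIV. m (fst (snd p)) (fst p) (snd (snd p)) i a * N i (Xh (fst p) (snd (snd p)))) \<in> borel_measurable ?LM" for a
      proof (intro borel_measurable_sum borel_measurable_times)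
        fix i
        show "(\<lambda>p. m (fst (snd p)) (fst p) (snd (snd p)) i a) \<in> borel_measurable ?LM"
          using measurable_compose[OF sw mm] by simp
        have "N i \<in> borel_measurable borel" by measurable
        from measurable_compose[OF sw Xm0(2)[OF this]]
        show "(\<lambda>p. N i (Xh (fst p) (snd (snd p)))) \<in> borel_measurable ?LM" by simp
      qed
      then have 1: "(\<lambda>p. \<chi> a. \<Sum>i\<in>UNIV. m (fst (snd p)) (fst p) (snd (snd p)) i a * N i (Xh (fst p) (snd (snd p)))) \<in> borel_measurable ?LM"
        by (intro borel_measurable_vecI) simp
      have 2: "(\<lambda>p. indicator ({0..T} \<times> {0..T}) (fst p, fst (snd p)) *\<^sub>R Df (fst p) (fst (snd p)) (snd (snd p))) \<in> borel_measurable ?LM"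
        using assms(17) by (simp add: case_prod_beta')
      note [measurable] = borel_measurable_diff[OF 2 1]
      show ?thesis
        unfolding Z_def case_prod_beta'
        by measurable
    qed
    have "AE s in lborel. AE (u, \<omega>) in lborel \<Otimes>\<^sub>M M. Z u s \<omega> = 0"
    proof (rule AE_pair_measure_exchange[OF _ _ _ Zm])
      show "AE u in lborel. AE (s, \<omega>) in lborel \<Otimes>\<^sub>M M. Z u s \<omega> = 0"
      proof (rule AE_I2)
        fix u
        show "AE (s, \<omega>) in lborel \<Otimes>\<^sub>M M. Z u s \<omega> = 0"
        proof (cases "u \<in> {0..T}")
          case True
          show ?thesis using assms(18)[OF True]
          proof eventually_elim
            case (elim p)
            obtain s \<omega> where p: "p = (s, \<omega>)" by (cases p)
            have "Df u s \<omega> = (\<chi> a. \<Sum>i\<in>UNIV. m s u \<omega> i a * N i (Xh u \<omega>))" if "0 \<le> s" "s \<le> u"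
              using elim p that True by (simp add: vec_eq_iff along m_def Xh Yh mult.commute)
            then show ?case using True by (auto simp: p Z_def)
          qed
        next
          case False
          then show ?thesis by (auto simp: Z_def intro!: AE_I2)
        qed
      qed
    qed (standard)+
    then show ?thesis
    proof eventually_elim
      case (elim s)
      then show ?case
      proof eventually_elim
        case (elim p)
        then show ?case
          by (cases p) (auto simp: Z_def)
      qed
    qed
  qed

  interpret L: pair_sigma_finite lborel M ..
  \<comment> \<open>The strict triangle of \<open>q\<close> and the closed one of the time integrals
    differ only for s = t, s = T, u = s or u = T.\<close>
  have AE_neq: "AE (u, \<omega>) in lborel \<Otimes>\<^sub>M M. u \<noteq> c" for c :: real
  proof (rule L.AE_pair_measure)
    show "{x \<in> space (lborel \<Otimes>\<^sub>M M). case x of (u, \<omega>) \<Rightarrow> u \<noteq> c} \<in> sets (lborel \<Otimes>\<^sub>M M)"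
      unfolding case_prod_beta' by measurable
  qed (use AE_lborel_singleton[of c] in auto)
  have q_eq: "AE s in lborel. AE (u, \<omega>) in lborel \<Otimes>\<^sub>M M.
        q s u \<omega> = indicator {t..T} s * (indicator {s..T} u * (\<Sum>j\<in>UNIV. A j s \<omega> * b j s u \<omega>))"
    using ex AE_lborel_singleton[of t] AE_lborel_singleton[of T]
  proof eventually_elim
    fix s assume *: "AE (u, \<omega>) in lborel \<Otimes>\<^sub>M M. 0 \<le> s \<and> s \<le> u \<and> u \<le> T \<longrightarrow>
      (\<forall>a. Df u s \<omega> $ a = (\<Sum>i\<in>UNIV. m s u \<omega> i a * N i (Xh u \<omega>)))" and s: "s \<noteq> t" "s \<noteq> T"
    show "AE (u, \<omega>) in lborel \<Otimes>\<^sub>M M.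
        q s u \<omega> = indicator {t..T} s * (indicator {s..T} u * (\<Sum>j\<in>UNIV. A j s \<omega> * b j s u \<omega>))"
      using * AE_neq[of s] AE_neq[of T]
    proof eventually_elim
      case (elim p)
      obtain u \<omega> where p: "p = (u, \<omega>)" by (cases p)
      show ?case
      proof (cases "t < s \<and> s < u \<and> u < T")
        case True
        then have "(\<Sum>j\<in>UNIV. A j s \<omega> * b j s u \<omega>) = E s u \<omega>"
          using elim tT p
          by (simp add: sum_option A_def b_def E_def along Xh sum_distrib_left mult.assoc)
        then show ?thesis using True p by (simp add: q_def)
      next
        case False
        then show ?thesis using elim s p by (auto simp: q_def split: split_indicator)
      qed
    qed
  qed

  \<comment> \<open>Identification of the conditional expectation\<close>
  obtain C where Cm: "(\<lambda>(u, \<omega>). C u \<omega>) \<in> borel_measurable (lborel \<Otimes>\<^sub>M M)"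
    and CV: "AE \<omega> in M. V2 \<omega> = (LINT u:{t..T}|lborel. C u \<omega>)"
    and CE: "AE u in lborel. u \<in> {t..T} \<longrightarrow> (AE \<omega> in M. C u \<omega> = real_cond_exp M (?F t)
           (\<lambda>\<omega>. V1 u \<omega> * along v0 z0 X (d_v f) u \<omega> + (\<Sum>a\<in>UNIV. Z1 u \<omega> $ a * along v0 z0 X (d_z a f) u \<omega>)) \<omega>)"
    using assms(21) unfolding is_integral_of_cond_exp_def by blast
  \<comment> \<open>\<open>V2\<close> is given only up to a null set and may fail to be measurable
    for \<open>M\<close>; \<open>V\<close> is a measurable version of it.\<close>
  define V where "V \<omega> = (LINT u:{t..T}|lborel. C u \<omega>)" for \<omega>
  have V2V: "AE \<omega> in M. V2 \<omega> = V \<omega>" using CV by (simp add: V_def)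
  have Vm: "V \<in> borel_measurable M"
  proof -
    have "(\<lambda>p. (\<lambda>(u, \<omega>). C u \<omega>) (snd p, fst p)) \<in> borel_measurable (M \<Otimes>\<^sub>M lborel)"
      by (rule measurable_compose[OF _ Cm]) measurable
    then have [measurable]: "(\<lambda>p. C (snd p) (fst p)) \<in> borel_measurable (M \<Otimes>\<^sub>M lborel)" by simp
    show ?thesis unfolding V_def[abs_def] set_lebesgue_integral_def
      by (rule lborel.borel_measurable_lebesgue_integral) (simp add: case_prod_beta')
  qed
  have V_int: "is_integral_of_cond_exp M (?F t) t T (\<lambda>s \<omega>. \<Sum>j\<in>UNIV. A j s \<omega> * R j s \<omega>) V"
  proof -
    let ?g = "\<lambda>u \<omega>. V1 u \<omega> * along v0 z0 X (d_v f) u \<omega>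
                    + (\<Sum>a\<in>UNIV. Z1 u \<omega> $ a * along v0 z0 X (d_z a f) u \<omega>)"
    have g: "(\<lambda>s \<omega>. \<Sum>j\<in>UNIV. A j s \<omega> * R j s \<omega>) = ?g"
      by (simp add: fun_eq_iff sum_option A_def R_def along mult.commute)
    have "integrable (lborel \<Otimes>\<^sub>M M) (\<lambda>(u, \<omega>). indicator {t..T} u * ?g u \<omega>)"
      using assms(21) unfolding is_integral_of_cond_exp_def by blast
    then have "is_integral_of_cond_exp M (?F t) t T ?g V"
      unfolding is_integral_of_cond_exp_def using Cm CE V_def[abs_def] by blast
    then show ?thesis unfolding g .
  qed

  interpret Ft: finite_measure_subalgebra M "?F t" by standard (use FM tT in auto)
  have eq: "integrable M V \<and> (LINT \<omega>|M. indicator B \<omega> * V \<omega>) = (LINT \<omega>|M. indicator B \<omega> * real_cond_exp M (?F t) H \<omega>)"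
    if B: "B \<in> sets M" for B
  proof -
    \<comment> \<open>The event \<open>B\<close> may depend on the interaction times. Its dual
      \<open>K\<close> is known at time t, so \<open>K \<omega> * q s u \<omega>\<close> is still
      measurable at time T and the times can be integrated out of the weighted integrand.\<close>
    obtain K where K: "K \<in> borel_measurable (?F t)" "\<And>\<omega>. 0 \<le> K \<omega>" "\<And>\<omega>. K \<omega> \<le> 1"
      and KE: "\<And>h. integrable M h \<Longrightarrow> (LINT \<omega>|M. indicator B \<omega> * real_cond_exp M (?F t) h \<omega>) = (LINT \<omega>|M. K \<omega> * h \<omega>)"
      using Ft.cond_exp_indicator_dual[OF B] by blast
    have iter: "integrable M V"
      "(LINT \<omega>|M. indicator B \<omega> * V \<omega>) = (LINT (s, u, \<omega>)|?LM. K \<omega> * q s u \<omega>)"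
      by (rule iterated_integral_of_cond_exp[of M t T UNIV ?F A b R V q "indicator B" K 1,
           OF finite_measure_axioms _ _ FM FF Am R V_int Vm qi q_eq _ K(1) _ _ KE];
        use tT B K in \<open>auto simp: indicator_def\<close>)+
    have KF: "K \<in> borel_measurable (?F T)" by (rule measurable_from_subalg[OF FF K(1)]) (use tT in simp)
    have Kq: "(\<lambda>(s, u, \<omega>). K \<omega> * q s u \<omega>) \<in> borel_measurable ?FT"
    proof -
      have [measurable]: "(\<lambda>p. q (fst p) (fst (snd p)) (snd (snd p))) \<in> borel_measurable ?FT"
        using qm by (simp add: case_prod_beta')
      note [measurable] = KF
      show ?thesis unfolding case_prod_beta' by measurable
    qed
    have "(LINT \<omega>|M. K \<omega> * H \<omega>) = (LINT (s, u, \<omega>)|?LM. K \<omega> * q s u \<omega>)"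
      using integral_over_interaction_times(2)[OF \<open>prob_space M\<close> FM[of T] \<tau> ind law Dm Dpos Kq] q0
      by (simp add: H_def)
    then show ?thesis using iter KE[OF Hi] by simp
  qed
  have VH: "AE \<omega> in M. V \<omega> = real_cond_exp M (?F t) H \<omega>"
    by (rule density_unique_real)
      (use eq Ft.real_cond_exp_int(1)[OF Hi] in \<open>auto simp: set_lebesgue_integral_def\<close>)
  \<comment> \<open>Only now are the two terms separated: the particle integrands \<open>H1\<close>
    and \<open>H2\<close> are individually integrable.\<close>
  have "AE \<omega> in M. real_cond_exp M (?F t) H \<omega> = real_cond_exp M (?F t) (\<lambda>\<omega>. H1 \<omega> + H2 \<omega>) \<omega>"
    by (rule Ft.real_cond_exp_cong) (use H_eq H1 H2 Hm in \<open>auto elim!: eventually_mono\<close>)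
  with V2V VH Ft.real_cond_exp_add[OF H1 H2] \<tau>_gt
  have "AE \<omega> in M. V2 \<omega> = indicator {\<omega>. t < \<tau>\<^sub>1 \<omega>} \<omega> * real_cond_exp M (?F t) H1 \<omega>
      + indicator {\<omega>. t < \<tau>\<^sub>1 \<omega>} \<omega> * real_cond_exp M (?F t) H2 \<omega>"
    by eventually_elim simp
  then show ?thesis unfolding H1_def H2_def .
qed

end
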